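(* Let $n\ge2$. A Frenet curve $\bar\gamma:I\subset\mathbb{R}\to\mathbb{C}P^n$ parametrized by arc-length with $\bar\tau_{12}$ different from $0$, $1$ or $-1$ is proper-biharmonic if and only if there is a constant $\alpha_0\in\left(\frac{\pi}{2},\pi\right)\cup\left(\frac{3\pi}{2},2\pi\right)$ such that $$\bar J\bar E_1=\cos\alpha_0\,\bar E_2+\sin\alpha_0\,\bar E_4$$ and $$ \begin{cases} \bar k_1,\bar k_2,\bar k_3=\text{constant}>0\\ \bar k_1^2+\bar k_2^2=1+3\cos^2\alpha_0\\ \bar k_2\bar k_3=-\frac32\sin(2\alpha_0)\\ \bar\tau_{12}=-\cos\alpha_0 . \end{cases} $$
   Context: $\mathbb{C}P^n$ carries the Fubini-Study metric $\langle\cdot,\cdot\rangle$ of constant holomorphic sectional curvature $4$, with complex structure $\bar J$ and Levi-Civita connection $\bar\nabla$. A curve $\bar\gamma:I\subset\mathbb{R}\to\mathbb{C}P^n$ parametrized by arc-length is a Frenet curve of osculating order $d$ ($1\le d\le 2n$) if there exist $d$ orthonormal vector fields $\bar E_1=\bar\gamma',\dots,\bar E_d$ along $\bar\gamma$ such that $\bar\nabla_{\bar E_1}\bar E_1=\bar k_1\bar E_2$, $\bar\nabla_{\bar E_1}\bar E_i=-\bar k_{i-1}\bar E_{i-1}+\bar k_i\bar E_{i+1}$ for $2\le i\le d-1$, $\bar\nabla_{\bar E_1}\bar E_d=-\bar k_{d-1}\bar E_{d-1}$, where $\bar k_1,\dots,\bar k_{d-1}$ are positive functions (the curvatures). The complex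 torsions are $\bar\tau_{ij}=\langle\bar E_i,\bar J\bar E_j\rangle$, $1\le i<j\le d$. (The condition on the right of the equivalence in particular includes that the osculating order is at least $4$.) A map $\varphi:(M,g)\to(N,h)$ is biharmonic if $\tau_2(\varphi)=-\Delta^{\varphi}\tau(\varphi)-\operatorname{trace}R^N(d\varphi,\tau(\varphi))d\varphi=0$, where $\tau(\varphi)=\operatorname{trace}\nabla d\varphi$, $\Delta^\varphi=-\operatorname{trace}(\nabla^\varphi)^2$ and $R^N(X,Y)Z=\nabla_X\nabla_YZ-\nabla_Y\nabla_XZ-\nabla_{[X,Y]}Z$; it is proper-biharmonic if moreover it is not harmonic. A curve is proper-biharmonic if it is so as a map from the interval $I$. *)

theory Defs
  imports "HOL-Analysis.Analysis"
begin

text \<open>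
  With \<open>CARD('m) = n + 1\<close>, \<open>CP\<^sup>n\<close> is the set of complex lines in \<open>complex ^ 'm\<close>, the line through
  \<open>z\<close> being represented by the Hermitian matrix \<open>z z\<^sup>* / |z|\<^sup>2\<close> of the orthogonal projection onto it
  (so two vectors give the same point iff they are proportional, see \<open>hpoint_eq_iff\<close>).  This
  realises \<open>CP\<^sup>n\<close> as a submanifold of the Euclidean space of Hermitian matrices.
\<close>

definition hpoint :: "complex ^ 'm \<Rightarrow> complex ^ 'm ^ 'm" where
  "hpoint z = (\<chi> i j. z $ i * cnj (z $ j) / of_real ((norm z)\<^sup>2))"

definition cproj :: "(complex ^ 'm ^ 'm) set" where
  "cproj = hpoint ` (- {0})"

definition hadj :: "complex ^ 'm ^ 'm \<Rightarrow> complex ^ 'm ^ 'm" where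
  "hadj A = (\<chi> i j. cnj (A $ j $ i))"

text \<open>
  The tangent space: differentiating \<open>P\<^sup>* = P\<close> and \<open>P\<^sup>2 = P\<close> gives the two conditions.
  See \<open>tangent_hpoint\<close> for the description by horizontal vectors of the Hopf fibration.
\<close>

definition tangent :: "complex ^ 'm ^ 'm \<Rightarrow> (complex ^ 'm ^ 'm) set" where
  "tangent P = {X. hadj X = X \<and> P ** X + X ** P = X}"

text \<open>
  The metric and the complex structure.  The inner product of \<open>complex ^ 'm ^ 'm\<close> is
  \<open>Re (trace (A\<^sup>* B))\<close>; the factor \<open>1/2\<close> makes the Hopf map from the unit sphere a Riemannian
  submersion and the holomorphic sectional curvature equal to 4 (\<open>fs_metric_hopf\<close>,
  \<open>holomorphic_sectional_curvature\<close>).  The complex structure is multiplication of horizontal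
  vectors by \<open>\<i>\<close> (\<open>cstruct_hopf\<close>).
\<close>

definition fs_metric :: "complex ^ 'm ^ 'm \<Rightarrow> complex ^ 'm ^ 'm \<Rightarrow> real" where
  "fs_metric X Y = (X \<bullet> Y) / 2"

definition cstruct :: "complex ^ 'm ^ 'm \<Rightarrow> complex ^ 'm ^ 'm \<Rightarrow> complex ^ 'm ^ 'm" where
  "cstruct P X = (\<chi> i j. \<i> * (X ** P - P ** X) $ i $ j)"

text \<open>
  For \<open>P\<close> in \<open>cproj\<close> this is the orthogonal projection of the Hermitian matrices onto \<open>tangent P\<close>
  (\<open>tan_proj_in_tangent\<close>, \<open>tan_proj_orthogonal\<close>).
\<close>

definition tan_proj :: "complex ^ 'm ^ 'm \<Rightarrow> complex ^ 'm ^ 'm \<Rightarrow> complex ^ 'm ^ 'm" where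
  "tan_proj P A = P ** A + A ** P - 2 *\<^sub>R (P ** A ** P)"

text \<open>
  The Levi-Civita connection of a submanifold of Euclidean space is the tangential part of the
  ordinary derivative.  Vector fields on \<open>cproj\<close> are given by functions on the ambient space, only
  their values on \<open>cproj\<close> being relevant.  Torsion-freeness and compatibility with the metric are
  proved below (\<open>nabla_torsion_free\<close>, \<open>covD_metric\<close>).
\<close>

type_synonym 'm vfield = "complex ^ 'm ^ 'm \<Rightarrow> complex ^ 'm ^ 'm"

definition nabla :: "'m vfield \<Rightarrow> 'm vfield \<Rightarrow> 'm::finite vfield" where
  "nabla X Y P = tan_proj P (frechet_derivative Y (at P) (X P))"

definition lie_bracket :: "'m vfield \<Rightarrow> 'm vfield \<Rightarrow> 'm::finite vfield" where
  "lie_bracket X Y P =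
     frechet_derivative Y (at P) (X P) - frechet_derivative X (at P) (Y P)"

definition curvature :: "'m vfield \<Rightarrow> 'm vfield \<Rightarrow> 'm vfield \<Rightarrow> 'm::finite vfield" where
  "curvature X Y Z P =
     nabla X (nabla Y Z) P - nabla Y (nabla X Z) P - nabla (lie_bracket X Y) Z P"

text \<open>
  The curvature operator is tensorial, so that on tangent vectors it can be evaluated with any
  smooth extensions to tangent vector fields; we extend \<open>u\<close> by its projections \<open>tan_proj Q u\<close>.
\<close>

definition riemann ::
    "complex ^ 'm ^ 'm \<Rightarrow> complex ^ 'm ^ 'm \<Rightarrow> complex ^ 'm ^ 'm \<Rightarrow> complex ^ 'm ^ 'm
       \<Rightarrow> complex ^ 'm ^ 'm" where
  "riemann P u v w = curvature (\<lambda>Q. tan_proj Q u) (\<lambda>Q. tan_proj Q v) (\<lambda>Q. tan_proj Q w) P"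

text \<open>
  Curves are defined on a nondegenerate interval \<open>I\<close>; the derivatives at end points belonging to
  \<open>I\<close> are one-sided.
\<close>

fun iter_deriv :: "real set \<Rightarrow> nat \<Rightarrow> (real \<Rightarrow> 'a::real_normed_vector) \<Rightarrow> real \<Rightarrow> 'a" where
  "iter_deriv I 0 f = f"
| "iter_deriv I (Suc k) f = (\<lambda>t. vector_derivative (iter_deriv I k f) (at t within I))"

definition smooth_on :: "real set \<Rightarrow> (real \<Rightarrow> 'a::real_normed_vector) \<Rightarrow> bool" where
  "smooth_on I f \<longleftrightarrow> (\<forall>k. iter_deriv I k f differentiable_on I)"

definition velocity :: "real set \<Rightarrow> (real \<Rightarrow> complex ^ 'm ^ 'm) \<Rightarrow> real \<Rightarrow> complex ^ 'm ^ 'm" where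
  "velocity I \<gamma> t = vector_derivative \<gamma> (at t within I)"

definition covD ::
    "real set \<Rightarrow> (real \<Rightarrow> complex ^ 'm ^ 'm) \<Rightarrow> (real \<Rightarrow> complex ^ 'm ^ 'm)
       \<Rightarrow> real \<Rightarrow> complex ^ 'm ^ 'm" where
  "covD I \<gamma> V t = tan_proj (\<gamma> t) (vector_derivative V (at t within I))"

text \<open>
  The domain is a flat interval with the unit parallel frame \<open>d/dt\<close>, so that all traces over the
  domain consist of a single term.
\<close>

definition tension :: "real set \<Rightarrow> (real \<Rightarrow> complex ^ 'm ^ 'm) \<Rightarrow> real \<Rightarrow> complex ^ 'm ^ 'm" where
  "tension I \<gamma> = covD I \<gamma> (velocity I \<gamma>)"

definition rough_laplacian ::
    "real set \<Rightarrow> (real \<Rightarrow> complex ^ 'm ^ 'm) \<Rightarrow> (real \<Rightarrow> complex ^ 'm ^ 'm)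
       \<Rightarrow> real \<Rightarrow> complex ^ 'm ^ 'm" where
  "rough_laplacian I \<gamma> V t = - covD I \<gamma> (covD I \<gamma> V) t"

definition bitension :: "real set \<Rightarrow> (real \<Rightarrow> complex ^ 'm ^ 'm) \<Rightarrow> real \<Rightarrow> complex ^ 'm ^ 'm" where
  "bitension I \<gamma> t = - rough_laplacian I \<gamma> (tension I \<gamma>) t
     - riemann (\<gamma> t) (velocity I \<gamma> t) (tension I \<gamma> t) (velocity I \<gamma> t)"

definition harmonic :: "real set \<Rightarrow> (real \<Rightarrow> complex ^ 'm ^ 'm) \<Rightarrow> bool" where
  "harmonic I \<gamma> \<longleftrightarrow> (\<forall>t\<in>I. tension I \<gamma> t = 0)"

definition biharmonic :: "real set \<Rightarrow> (real \<Rightarrow> complex ^ 'm ^ 'm) \<Rightarrow> bool" where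
  "biharmonic I \<gamma> \<longleftrightarrow> (\<forall>t\<in>I. bitension I \<gamma> t = 0)"

definition proper_biharmonic :: "real set \<Rightarrow> (real \<Rightarrow> complex ^ 'm ^ 'm) \<Rightarrow> bool" where
  "proper_biharmonic I \<gamma> \<longleftrightarrow> biharmonic I \<gamma> \<and> \<not> harmonic I \<gamma>"

text \<open>
  \<open>frenet_curve I \<gamma> d E k\<close>: the curve \<open>\<gamma>\<close> is a Frenet curve of osculating order \<open>d\<close> with Frenet frame
  \<open>E 1, \<dots>, E d\<close> and curvatures \<open>k 1, \<dots>, k (d - 1)\<close>; other indices are irrelevant.
  The condition \<open>E 1 = \<gamma>'\<close> includes the parametrisation by arc length.
\<close>

definition frenet_curve ::
    "real set \<Rightarrow> (real \<Rightarrow> complex ^ 'm ^ 'm) \<Rightarrow> nat \<Rightarrow> (nat \<Rightarrow> real \<Rightarrow> complex ^ 'm ^ 'm)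
       \<Rightarrow> (nat \<Rightarrow> real \<Rightarrow> real) \<Rightarrow> bool" where
  "frenet_curve I \<gamma> d E k \<longleftrightarrow>
     is_interval I \<and> interior I \<noteq> {} \<and>
     smooth_on I \<gamma> \<and> (\<forall>t\<in>I. \<gamma> t \<in> cproj) \<and>
     1 \<le> d \<and> d \<le> 2 * (CARD('m) - 1) \<and>
     (\<forall>i\<in>{1..d}. smooth_on I (E i) \<and> (\<forall>t\<in>I. E i t \<in> tangent (\<gamma> t))) \<and>
     (\<forall>t\<in>I. \<forall>i\<in>{1..d}. \<forall>j\<in>{1..d}. fs_metric (E i t) (E j t) = (if i = j then 1 else 0)) \<and>
     (\<forall>t\<in>I. E 1 t = velocity I \<gamma> t) \<and>
     (\<forall>i\<in>{1..<d}. \<forall>t\<in>I. k i t > 0) \<and>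
     (\<forall>i\<in>{1..d}. \<forall>t\<in>I. covD I \<gamma> (E i) t =
        (if i = 1 then 0 else - (k (i - 1) t *\<^sub>R E (i - 1) t)) +
        (if i = d then 0 else k i t *\<^sub>R E (i + 1) t))"

definition complex_torsion ::
    "(real \<Rightarrow> complex ^ 'm ^ 'm) \<Rightarrow> (nat \<Rightarrow> real \<Rightarrow> complex ^ 'm ^ 'm) \<Rightarrow> nat \<Rightarrow> nat \<Rightarrow> real \<Rightarrow> real"
  where
  "complex_torsion \<gamma> E i j t = fs_metric (E i t) (cstruct (\<gamma> t) (E j t))"

definition hinner :: "complex ^ 'm \<Rightarrow> complex ^ 'm \<Rightarrow> complex" where
  "hinner a b = (\<Sum>i\<in>UNIV. cnj (a $ i) * b $ i)"

definition outer :: "complex ^ 'm \<Rightarrow> complex ^ 'm \<Rightarrow> complex ^ 'm ^ 'm" where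
  "outer a b = (\<chi> i j. a $ i * cnj (b $ j))"

lemma matrix_mult_bounded_bilinear:
  "bounded_bilinear ((**) :: complex ^ 'm ^ 'm \<Rightarrow> complex ^ 'm ^ 'm \<Rightarrow> complex ^ 'm ^ 'm)"
  by (rule bilinear_conv_bounded_bilinear[THEN iffD1])
     (auto simp: bilinear_def linear_iff matrix_matrix_mult_def vec_eq_iff algebra_simps
       sum.distrib scaleR_sum_right)

interpretation mm: bounded_bilinear
  "(**) :: complex ^ 'm ^ 'm \<Rightarrow> complex ^ 'm ^ 'm \<Rightarrow> complex ^ 'm ^ 'm"
  by (rule matrix_mult_bounded_bilinear)

lemma outer_mult: "outer a b ** outer c d = (\<chi> i j. hinner b c * outer a d $ i $ j)"
  by (simp add: outer_def hinner_def matrix_matrix_mult_def vec_eq_iff sum_distrib_left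
      sum_distrib_right mult_ac)

lemma hinner_self: "hinner z z = of_real ((norm z)\<^sup>2)"
proof -
  have "hinner z z = of_real (\<Sum>i\<in>UNIV. (norm (z $ i))\<^sup>2)"
    by (simp add: hinner_def complex_norm_square mult.commute del: of_real_power)
  then show ?thesis
    by (simp add: norm_vec_def L2_set_def sum_nonneg)
qed

lemma hpoint_unit: "norm z = 1 \<Longrightarrow> hpoint z = outer z z"
  by (simp add: hpoint_def outer_def)

lemma norm_cscale: "norm (c *s (z :: complex ^ 'm)) = cmod c * norm z"
proof -
  have "(\<Sum>i\<in>UNIV. (cmod (c * z $ i))\<^sup>2) = (cmod c)\<^sup>2 * (\<Sum>i\<in>UNIV. (cmod (z $ i))\<^sup>2)"
    by (simp add: norm_mult power_mult_distrib sum_distrib_left)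
  then show ?thesis by (simp add: norm_vec_def L2_set_def real_sqrt_mult)
qed

lemma hpoint_scale:
  fixes z :: "complex ^ 'm"
  assumes "c \<noteq> 0"
  shows "hpoint (c *s z) = hpoint z"
proof -
  have c: "c * cnj c = of_real ((cmod c)\<^sup>2)" by (simp only: complex_norm_square)
  have "c * z $ i * (cnj c * cnj (z $ j)) / of_real ((cmod c * norm z)\<^sup>2)
      = z $ i * cnj (z $ j) / of_real ((norm z)\<^sup>2)" for i j
  proof -
    have "c * z $ i * (cnj c * cnj (z $ j)) = of_real ((cmod c)\<^sup>2) * (z $ i * cnj (z $ j))"
      by (simp only: c[symmetric] mult_ac)
    moreover have nz: "complex_of_real ((cmod c)\<^sup>2) \<noteq> 0" using assms by simp
    ultimately show ?thesis
      by (simp only: power_mult_distrib of_real_mult mult_divide_mult_cancel_left[OF nz])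
  qed
  then show ?thesis
    by (simp add: hpoint_def norm_cscale vec_eq_iff)
qed

lemma hpoint_eq_iff:
  fixes z w :: "complex ^ 'm"
  assumes "z \<noteq> 0" "w \<noteq> 0"
  shows "hpoint z = hpoint w \<longleftrightarrow> (\<exists>c. w = c *s z)"
proof
  assume "\<exists>c. w = c *s z"
  then obtain c where "w = c *s z" by blast
  moreover have "c \<noteq> 0" using assms calculation by auto
  ultimately show "hpoint z = hpoint w" by (simp add: hpoint_scale)
next
  assume eq: "hpoint z = hpoint w"
  obtain j where j: "w $ j \<noteq> 0" using assms(2) by (auto simp: vec_eq_iff)
  have cross: "y = c / A * B / d * x"
    if "x * c / A = y * d / B" "B \<noteq> 0" "d \<noteq> 0" for x y c d A B :: complex
  proof -
    have "y = y * d / B * B / d" using that(2,3) by simp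
    also have "\<dots> = x * c / A * B / d" by (simp only: that(1))
    finally show ?thesis by (simp only: divide_inverse mult_ac)
  qed
  let ?c = "cnj (z $ j) / of_real ((norm z)\<^sup>2) * of_real ((norm w)\<^sup>2) / cnj (w $ j)"
  have "w $ i = (?c *s z) $ i" for i
  proof -
    have "hpoint z $ i $ j = hpoint w $ i $ j" using eq by simp
    then have "z $ i * cnj (z $ j) / of_real ((norm z)\<^sup>2)
        = w $ i * cnj (w $ j) / of_real ((norm w)\<^sup>2)"
      by (simp add: hpoint_def)
    moreover have "complex_of_real ((norm w)\<^sup>2) \<noteq> 0" "cnj (w $ j) \<noteq> 0"
      using assms j by simp_all
    ultimately have "w $ i = ?c * z $ i" by (rule cross)
    then show ?thesis by (simp only: vector_smult_component)
  qed
  then have "w = ?c *s z" unfolding vec_eq_iff by blast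
  then show "\<exists>c. w = c *s z" by blast
qed

lemma cproj_unitE:
  assumes "P \<in> cproj"
  obtains z where "norm z = 1" "P = hpoint z"
proof -
  obtain z where z: "z \<noteq> 0" "P = hpoint z" using assms by (auto simp: cproj_def)
  let ?w = "of_real (1 / norm z) *s z"
  have "norm ?w = 1" using z by (simp add: norm_cscale norm_divide)
  moreover have "P = hpoint ?w" using z by (simp add: hpoint_scale)
  ultimately show ?thesis using that by blast
qed

lemma hpoint_proj:
  assumes "norm z = 1"
  shows "hpoint z ** hpoint z = hpoint z" "hadj (hpoint z) = hpoint z"
  using assms
  by (simp_all add: hpoint_unit outer_mult hinner_self)
     (simp_all add: outer_def hadj_def mult.commute)

lemma cproj_proj: "P \<in> cproj \<Longrightarrow> P ** P = P" "P \<in> cproj \<Longrightarrow> hadj P = P"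
  using cproj_unitE hpoint_proj by metis+

text \<open>The differential of the Hopf map, whose kernel is spanned by the vertical vector \<open>\<i> z\<close>.\<close>

definition hlift :: "complex ^ 'm \<Rightarrow> complex ^ 'm \<Rightarrow> complex ^ 'm ^ 'm" where
  "hlift z w = outer w z + outer z w"

lemma hopf_derivative:
  fixes c :: "real \<Rightarrow> complex ^ 'm"
  assumes c: "(c has_vector_derivative c') (at t within S)"
    and unit: "\<And>s. s \<in> S \<Longrightarrow> norm (c s) = 1" and t: "t \<in> S"
  shows "((\<lambda>s. hpoint (c s)) has_vector_derivative hlift (c t) c') (at t within S)"
proof -
  have ci: "((\<lambda>s. c s $ i) has_vector_derivative c' $ i) (at t within S)" for i
    using bounded_linear.has_vector_derivative[OF bounded_linear_vec_nth c] .
  have "((\<lambda>s. outer (c s) (c s)) has_vector_derivative hlift (c t) c') (at t within S)"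
    unfolding has_vector_derivative_def
  proof (subst has_derivative_componentwise_within, rule ballI)
    fix b :: "complex ^ 'm ^ 'm" assume "b \<in> Basis"
    have *: "((\<lambda>s. c s $ i * cnj (c s $ j)) has_vector_derivative
        (c t $ i * cnj (c' $ j) + c' $ i * cnj (c t $ j))) (at t within S)" for i j
      by (rule has_vector_derivative_mult[OF ci
            bounded_linear.has_vector_derivative[OF bounded_linear_cnj ci]])
    have "((\<lambda>s. outer (c s) (c s) \<bullet> b) has_vector_derivative (hlift (c t) c' \<bullet> b))
        (at t within S)"
      unfolding inner_vec_def outer_def hlift_def
      by (auto intro!: has_vector_derivative_sum has_vector_derivative_eq_rhs[OF
            bounded_linear.has_vector_derivative[OF bounded_linear_inner_left *]]
          simp: add.commute)
    then show "((\<lambda>s. outer (c s) (c s) \<bullet> b) has_derivative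
        (\<lambda>x. (x *\<^sub>R hlift (c t) c') \<bullet> b)) (at t within S)"
      by (simp add: has_vector_derivative_def)
  qed
  then show ?thesis
    by (rule has_vector_derivative_transform[OF t, rotated]) (simp add: unit hpoint_unit)
qed

lemma tangent_hpoint:
  assumes "norm z = 1"
  shows "tangent (hpoint z) = hlift z ` {w. hinner z w = 0}"
proof (intro subset_antisym subsetI)
  fix X assume X: "X \<in> tangent (hpoint z)"
  have h: "cnj (X $ j $ i) = X $ i $ j" for i j
    using X by (simp add: tangent_def hadj_def vec_eq_iff)
  have zz: "hinner z z = 1" using assms by (simp add: hinner_self)
  let ?w = "X *v z"
  have XP: "X ** hpoint z = outer ?w z"
    using assms by (simp add: hpoint_unit outer_def matrix_matrix_mult_def
        matrix_vector_mult_def vec_eq_iff sum_distrib_right mult.assoc)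
  have PX: "hpoint z ** X = outer z ?w"
    using assms by (simp add: hpoint_unit outer_def matrix_matrix_mult_def
        matrix_vector_mult_def vec_eq_iff sum_distrib_left h mult_ac)
  have Xw: "X = hlift z ?w" using X XP PX by (simp add: tangent_def hlift_def add.commute)
  have "?w = hlift z ?w *v z" using Xw by simp
  also have "\<dots> = (\<chi> i. ?w $ i * hinner z z + z $ i * hinner ?w z)"
    by (simp add: hlift_def matrix_vector_mult_add_rdistrib)
       (simp add: outer_def matrix_vector_mult_def[of "\<chi> i j. _ i j"] hinner_def vec_eq_iff
         sum_distrib_left mult_ac)
  finally have "z $ i * hinner ?w z = 0" for i by (auto simp: vec_eq_iff zz)
  moreover obtain i where "z $ i \<noteq> 0" using assms by (metis norm_zero vec_eq_iff zero_index zero_neq_one)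
  ultimately have "hinner ?w z = 0" by (metis mult_eq_0_iff)
  then have "cnj (hinner ?w z) = 0" by simp
  then have "hinner z ?w = 0" by (simp add: hinner_def mult.commute)
  then show "X \<in> hlift z ` {w. hinner z w = 0}" using Xw by blast
next
  fix X assume "X \<in> hlift z ` {w. hinner z w = 0}"
  then obtain w where w: "hinner z w = 0" and X: "X = hlift z w" by blast
  have "cnj (hinner z w) = 0" using w by simp
  then have w': "hinner w z = 0" by (simp add: hinner_def mult.commute)
  have zz: "hinner z z = 1" using assms by (simp add: hinner_self)
  have "hadj X = X"
    by (simp add: X hlift_def hadj_def outer_def vec_eq_iff mult.commute add.commute)
  moreover have "hpoint z ** X + X ** hpoint z = X"
    using assms by (simp add: X hlift_def hpoint_unit mm.add_left mm.add_right
        outer_mult w w' zz vec_eq_iff)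
  ultimately show "X \<in> tangent (hpoint z)" by (simp add: tangent_def)
qed

lemma inner_complex_Re: "a \<bullet> b = Re (cnj a * b)" for a b :: complex
  by (simp add: inner_complex_def)

lemma inner_outer: "outer a b \<bullet> outer c d = Re (hinner a c * hinner d b)"
proof -
  have "hinner a c * hinner d b
      = (\<Sum>i\<in>UNIV. \<Sum>j\<in>UNIV. (cnj (a $ i) * c $ i) * (cnj (d $ j) * b $ j))"
    by (simp add: hinner_def sum_product)
  then show ?thesis
    by (simp add: inner_vec_def outer_def inner_complex_Re mult_ac del: times_complex.sel)
qed

lemma Re_hinner: "Re (hinner v w) = v \<bullet> w"
  by (simp add: hinner_def inner_vec_def inner_complex_def)

lemma fs_metric_hopf:
  assumes "norm z = 1" "hinner z v = 0" "hinner z w = 0"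
  shows "fs_metric (hlift z v) (hlift z w) = v \<bullet> w"
proof -
  have zz: "hinner z z = 1" using assms by (simp add: hinner_self)
  have "cnj (hinner z v) = 0" using assms by simp
  then have "hinner v z = 0" by (simp add: hinner_def mult.commute)
  then show ?thesis using assms
    by (simp add: fs_metric_def hlift_def inner_add_left inner_add_right inner_outer zz
        Re_hinner inner_commute)
qed

lemma cstruct_hopf:
  assumes "norm z = 1" "hinner z w = 0"
  shows "cstruct (hpoint z) (hlift z w) = hlift z (\<i> *s w)"
proof -
  have zz: "hinner z z = 1" using assms by (simp add: hinner_self)
  have "cnj (hinner z w) = 0" using assms by simp
  then have w: "hinner w z = 0" by (simp add: hinner_def mult.commute)
  show ?thesis using assms
    by (simp add: cstruct_def hpoint_unit hlift_def mm.add_left mm.add_right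
        outer_mult zz w vec_eq_iff)
       (simp add: outer_def algebra_simps)
qed

lemma tangentD:
  assumes "X \<in> tangent P"
  shows "hadj X = X" "P ** X = X - X ** P"
  using assms by (auto simp: tangent_def algebra_simps)

lemmas mm_simps = mm.add_left mm.add_right mm.diff_left mm.diff_right mm.minus_left mm.minus_right
  mm.scaleR_left mm.scaleR_right matrix_mul_assoc[symmetric]

text \<open>Moving \<open>P\<close> to the right past tangent vectors.\<close>

lemma tangent_move:
  fixes P X A :: "complex ^ 'm ^ 'm"
  assumes "P \<in> cproj"
  shows "P ** P = P" "P ** (P ** A) = P ** A"
    and "X \<in> tangent P \<Longrightarrow> P ** X = X - X ** P"
    and "X \<in> tangent P \<Longrightarrow> P ** (X ** A) = X ** A - X ** (P ** A)"
  using cproj_proj(1)[OF assms] tangentD(2)[of X P]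
  by (simp_all add: matrix_mul_assoc mm.diff_left)

lemma hadj_mult: "hadj (A ** B) = hadj B ** hadj A"
  by (simp add: hadj_def matrix_matrix_mult_def vec_eq_iff mult.commute)

lemma hadj_linear: "hadj (A + B) = hadj A + hadj B" "hadj (A - B) = hadj A - hadj B"
  "hadj (r *\<^sub>R A) = r *\<^sub>R hadj A"
  by (simp_all add: hadj_def vec_eq_iff)

lemma tan_proj_in_tangent:
  assumes "P \<in> cproj" "hadj A = A"
  shows "tan_proj P A \<in> tangent P"
proof -
  have "hadj (tan_proj P A) = tan_proj P A"
    using assms by (simp add: tan_proj_def hadj_linear hadj_mult cproj_proj matrix_mul_assoc add.commute)
  moreover have "P ** tan_proj P A + tan_proj P A ** P = tan_proj P A"
    unfolding tan_proj_def scaleR_2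
    by (simp only: mm_simps tangent_move(1,2)[OF assms(1)]) simp
  ultimately show ?thesis by (simp add: tangent_def)
qed

lemma tan_proj_tangent:
  assumes "P \<in> cproj" "X \<in> tangent P"
  shows "tan_proj P X = X"
  unfolding tan_proj_def scaleR_2
  by (simp only: mm_simps tangent_move(1,2)[OF assms(1)] tangent_move(3,4)[OF assms]) simp

lemma inner_mult_left: "(A ** B) \<bullet> C = B \<bullet> (hadj A ** C)"
proof -
  let ?f = "\<lambda>i j l. Re (cnj (A $ i $ l) * (cnj (B $ l $ j) * C $ i $ j))"
  have "(A ** B) \<bullet> C = (\<Sum>i\<in>UNIV. \<Sum>j\<in>UNIV. \<Sum>l\<in>UNIV. ?f i j l)"
    by (simp only: inner_vec_def inner_complex_Re matrix_matrix_mult_def vec_lambda_beta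
        cnj_sum sum_distrib_right Re_sum complex_cnj_mult mult.assoc)
  also have "\<dots> = (\<Sum>j\<in>UNIV. \<Sum>i\<in>UNIV. \<Sum>l\<in>UNIV. ?f i j l)"
    by (rule sum.swap)
  also have "\<dots> = (\<Sum>j\<in>UNIV. \<Sum>l\<in>UNIV. \<Sum>i\<in>UNIV. ?f i j l)"
    by (rule sum.cong[OF refl], rule sum.swap)
  also have "\<dots> = (\<Sum>l\<in>UNIV. \<Sum>j\<in>UNIV. \<Sum>i\<in>UNIV. ?f i j l)"
    by (rule sum.swap)
  also have "\<dots> = B \<bullet> (hadj A ** C)"
    by (simp only: inner_vec_def inner_complex_Re matrix_matrix_mult_def hadj_def vec_lambda_beta
        sum_distrib_left Re_sum mult.left_commute)
  finally show ?thesis .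
qed

lemma inner_hadj: "hadj A \<bullet> hadj B = A \<bullet> B"
proof -
  have "hadj A \<bullet> hadj B = (\<Sum>i\<in>UNIV. \<Sum>j\<in>UNIV. A $ j $ i \<bullet> B $ j $ i)"
    by (simp add: inner_vec_def hadj_def inner_complex_def)
  also have "\<dots> = A \<bullet> B"
    unfolding inner_vec_def by (rule sum.swap)
  finally show ?thesis .
qed

lemma hadj_hadj: "hadj (hadj A) = A"
  by (simp add: hadj_def vec_eq_iff)

lemma inner_mult_right:
  fixes A B C :: "complex ^ 'm ^ 'm"
  shows "(A ** B) \<bullet> C = A \<bullet> (C ** hadj B)"
proof -
  have "(A ** B) \<bullet> C = (hadj B ** hadj A) \<bullet> hadj C"
    by (simp only: inner_hadj flip: hadj_mult)
  also have "\<dots> = hadj A \<bullet> (B ** hadj C)"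
    by (simp only: inner_mult_left hadj_hadj)
  also have "\<dots> = hadj A \<bullet> hadj (C ** hadj B)"
    by (simp only: hadj_mult hadj_hadj)
  finally show ?thesis by (simp only: inner_hadj)
qed

lemma tan_proj_self_adjoint:
  assumes "P \<in> cproj"
  shows "tan_proj P A \<bullet> B = A \<bullet> tan_proj P B"
  using cproj_proj(2)[OF assms]
  by (simp add: tan_proj_def inner_add_left inner_add_right inner_diff_left inner_diff_right
      inner_mult_left[of P] inner_mult_right[of _ P] mm_simps)

lemma tan_proj_orthogonal:
  assumes "P \<in> cproj" "X \<in> tangent P"
  shows "(A - tan_proj P A) \<bullet> X = 0"
  using assms by (simp add: inner_diff_left tan_proj_self_adjoint tan_proj_tangent)

lemma covD_metric:
  assumes "t \<in> I" "\<gamma> t \<in> cproj" "V t \<in> tangent (\<gamma> t)" "W t \<in> tangent (\<gamma> t)"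
    and "V differentiable (at t within I)" "W differentiable (at t within I)"
  shows "((\<lambda>s. fs_metric (V s) (W s)) has_vector_derivative
    fs_metric (covD I \<gamma> V t) (W t) + fs_metric (V t) (covD I \<gamma> W t)) (at t within I)"
proof -
  have "((\<lambda>s. V s \<bullet> W s) has_vector_derivative
      V t \<bullet> vector_derivative W (at t within I) + vector_derivative V (at t within I) \<bullet> W t)
      (at t within I)"
    using assms(5,6)
    by (intro bounded_bilinear.has_vector_derivative[OF bounded_bilinear_inner])
       (simp_all flip: vector_derivative_works)
  also have "V t \<bullet> vector_derivative W (at t within I) = V t \<bullet> covD I \<gamma> W t"
    using assms by (simp add: covD_def tan_proj_self_adjoint[symmetric] tan_proj_tangent)
  also have "vector_derivative V (at t within I) \<bullet> W t = covD I \<gamma> V t \<bullet> W t"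
    using assms by (simp add: covD_def tan_proj_self_adjoint tan_proj_tangent)
  finally have "((\<lambda>s. (V s \<bullet> W s) * (1 / 2)) has_vector_derivative
      (V t \<bullet> covD I \<gamma> W t + covD I \<gamma> V t \<bullet> W t) * (1 / 2)) (at t within I)"
    by (intro bounded_linear.has_vector_derivative[OF bounded_linear_mult_left])
  then show ?thesis
    by (simp add: fs_metric_def add.commute add_divide_distrib)
qed

text \<open>Derivative of the tangential projection in the direction \<open>h\<close>.\<close>

definition tan_proj' ::
    "complex ^ 'm ^ 'm \<Rightarrow> complex ^ 'm ^ 'm \<Rightarrow> complex ^ 'm ^ 'm \<Rightarrow> complex ^ 'm ^ 'm" where
  "tan_proj' P h A = h ** A + A ** h - 2 *\<^sub>R (h ** A ** P) - 2 *\<^sub>R (P ** A ** h)"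

lemma has_derivative_tan_proj:
  assumes "(Q has_derivative Q') (at x within S)" "(Y has_derivative Y') (at x within S)"
  shows "((\<lambda>x. tan_proj (Q x) (Y x)) has_derivative
    (\<lambda>h. tan_proj' (Q x) (Q' h) (Y x) + tan_proj (Q x) (Y' h))) (at x within S)"
  unfolding tan_proj_def
  by (rule has_derivative_eq_rhs, (rule derivative_intros mm.FDERIV assms)+)
     (simp add: fun_eq_iff tan_proj_def tan_proj'_def mm_simps algebra_simps)

lemma nabla_ext:
  fixes v w :: "complex ^ 'm ^ 'm"
  shows "nabla Y (\<lambda>Q. tan_proj Q w) = (\<lambda>Q. tan_proj Q (tan_proj' Q (Y Q) w))"
proof
  fix Q :: "complex ^ 'm ^ 'm"
  have "((\<lambda>Q. tan_proj Q w) has_derivative (\<lambda>h. tan_proj' Q h w)) (at Q)"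
    by (rule has_derivative_eq_rhs[OF has_derivative_tan_proj[OF has_derivative_ident
      has_derivative_const]]) (simp add: tan_proj_def)
  then show "nabla Y (\<lambda>Q. tan_proj Q w) Q = tan_proj Q (tan_proj' Q (Y Q) w)"
    by (simp add: nabla_def frechet_derivative_at[symmetric])
qed

lemma riemann_eq:
  fixes u v w :: "complex ^ 'm ^ 'm"
  assumes P: "P \<in> cproj" and "u \<in> tangent P" "v \<in> tangent P" "w \<in> tangent P"
  shows "riemann P u v w = (u ** v - v ** u) ** w - w ** (u ** v - v ** u)"
proof -
  have ext: "((\<lambda>Q. tan_proj Q v) has_derivative (\<lambda>h. tan_proj' P h v)) (at P)"
    for v :: "complex ^ 'm ^ 'm"
    by (rule has_derivative_eq_rhs[OF has_derivative_tan_proj[OF has_derivative_ident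
      has_derivative_const]]) (simp add: tan_proj_def)
  have ext': "((\<lambda>Q. tan_proj' Q (tan_proj Q v) w) has_derivative
      (\<lambda>h. tan_proj' P (tan_proj' P h v) w
        - 2 *\<^sub>R (tan_proj P v ** w ** h) - 2 *\<^sub>R (h ** w ** tan_proj P v))) (at P)"
    for v w :: "complex ^ 'm ^ 'm"
    unfolding tan_proj'_def[of _ "tan_proj _ _"]
    by (rule has_derivative_eq_rhs,
        (rule derivative_intros mm.FDERIV ext has_derivative_ident)+)
       (simp add: fun_eq_iff tan_proj'_def mm_simps algebra_simps)
  have nn: "nabla (\<lambda>Q. tan_proj Q u) (nabla (\<lambda>Q. tan_proj Q v) (\<lambda>Q. tan_proj Q w)) P =
      tan_proj P (tan_proj' P u (tan_proj' P v w) + tan_proj P (tan_proj' P (tan_proj' P u v) w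
        - 2 *\<^sub>R (v ** w ** u) - 2 *\<^sub>R (u ** w ** v)))"
    if "u \<in> tangent P" "v \<in> tangent P" for u v
    unfolding nabla_ext
    by (simp add: nabla_def tan_proj_tangent[OF P] that
        frechet_derivative_at[OF has_derivative_tan_proj[OF has_derivative_ident ext'], symmetric])
  have lb: "lie_bracket (\<lambda>Q. tan_proj Q u) (\<lambda>Q. tan_proj Q v) P
      = tan_proj' P u v - tan_proj' P v u"
    using assms by (simp add: lie_bracket_def frechet_derivative_at[OF ext, symmetric] tan_proj_tangent)
  have br: "nabla (lie_bracket (\<lambda>Q. tan_proj Q u) (\<lambda>Q. tan_proj Q v)) (\<lambda>Q. tan_proj Q w) P
      = tan_proj P (tan_proj' P (tan_proj' P u v - tan_proj' P v u) w)"
    by (simp only: nabla_ext lb)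
  note move = tangent_move(1,2)[OF P] tangent_move(3,4)[OF P assms(2)]
    tangent_move(3,4)[OF P assms(3)] tangent_move(3,4)[OF P assms(4)]
  have tt: "tan_proj P (tan_proj P A) = tan_proj P A" for A
    unfolding tan_proj_def scaleR_2 by (simp only: mm_simps move) simp
  have t0: "tan_proj P (A + B) = tan_proj P A + tan_proj P B"
    "tan_proj P (A - B) = tan_proj P A - tan_proj P B" for A B
    by (simp_all add: tan_proj_def mm_simps algebra_simps)
  have b0: "tan_proj' P u v - tan_proj' P v u = 0"
    by (simp add: tan_proj'_def mm_simps move scaleR_2)
  have b1: "tan_proj' P 0 w = 0" by (simp add: tan_proj'_def mm_simps)
  have n1: "tan_proj P (tan_proj' P (tan_proj' P u v) w) = tan_proj P (tan_proj' P (tan_proj' P v u) w)"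
    using b0 by simp
  have d: "tan_proj P (tan_proj' P u (tan_proj' P v w))
      = u ** (v ** w + w ** v) + (v ** w + w ** v) ** u"
    if "u \<in> tangent P" "v \<in> tangent P" for u v
  proof -
    note move = tangent_move(1,2)[OF P] tangent_move(3,4)[OF P that(1)]
      tangent_move(3,4)[OF P that(2)] tangent_move(3,4)[OF P assms(4)]
    have "tan_proj' P u (tan_proj' P v w) = u ** (v ** w + w ** v) + (v ** w + w ** v) ** u"
      unfolding tan_proj'_def scaleR_2 by (simp only: mm_simps move) simp
    moreover have "tan_proj P (u ** (v ** w + w ** v) + (v ** w + w ** v) ** u)
        = u ** (v ** w + w ** v) + (v ** w + w ** v) ** u"
      unfolding tan_proj_def scaleR_2 by (simp only: mm_simps move) simp
    ultimately show ?thesis by simp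
  qed
  have "riemann P u v w = tan_proj P (tan_proj' P u (tan_proj' P v w))
      - tan_proj P (tan_proj' P v (tan_proj' P u w))"
    by (simp only: riemann_def curvature_def nn[OF assms(2,3)] nn[OF assms(3,2)] br b0 b1 t0 tt n1)
       (simp add: tan_proj_def)
  then show ?thesis
    by (simp add: d assms mm_simps)
qed

lemma tangent_hpoint_curve:
  fixes z w :: "complex ^ 'm"
  assumes "norm z = 1" "hinner z w = 0"
  obtains \<gamma> where "\<gamma> (0::real) = hpoint z" "\<And>s. \<gamma> s \<in> cproj"
    "(\<gamma> has_vector_derivative hlift z w) (at 0)"
proof -
  let ?a = "\<lambda>s::real. inverse (sqrt (1 + s\<^sup>2 * (norm w)\<^sup>2))"
  define c where "c = (\<lambda>s. ?a s *\<^sub>R (z + s *\<^sub>R w))"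
  have zw: "z \<bullet> w = 0" using assms(2) by (simp flip: Re_hinner)
  have pos: "1 + s\<^sup>2 * (norm w)\<^sup>2 > 0" for s :: real
    by (intro add_pos_nonneg) auto
  have "(norm (z + s *\<^sub>R w))\<^sup>2 = 1 + s\<^sup>2 * (norm w)\<^sup>2" for s
  proof -
    have "(norm (z + s *\<^sub>R w))\<^sup>2 = (norm z)\<^sup>2 + 2 * s * (z \<bullet> w) + s\<^sup>2 * (norm w)\<^sup>2"
      unfolding power2_norm_eq_inner
      by (simp add: inner_add_left inner_add_right inner_commute[of w z] power2_eq_square distrib_left)
    then show ?thesis using zw assms(1) by simp
  qed
  then have nrm: "norm (z + s *\<^sub>R w) = sqrt (1 + s\<^sup>2 * (norm w)\<^sup>2)" for s
    by (metis norm_ge_zero real_sqrt_unique)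
  have unit: "norm (c s) = 1" for s
    using pos[of s] by (simp add: c_def nrm)
  have "(?a has_real_derivative 0) (at 0)"
    by (auto intro!: derivative_eq_intros)
  then have "(c has_vector_derivative (?a 0 *\<^sub>R w + 0 *\<^sub>R (z + 0 *\<^sub>R w))) (at 0)"
    unfolding c_def
    by (intro has_vector_derivative_scaleR) (auto intro!: derivative_eq_intros)
  then have "(c has_vector_derivative w) (at 0)" by simp
  from hopf_derivative[OF this unit] have "((\<lambda>s. hpoint (c s)) has_vector_derivative hlift z w) (at 0)"
    by (simp add: c_def)
  moreover have "hpoint (c s) \<in> cproj" for s
    using unit[of s] by (auto simp: cproj_def)
  ultimately show ?thesis
    using that[of "\<lambda>s. hpoint (c s)"] by (simp add: c_def)
qed

lemma derivative_tangent_field: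
  fixes Y :: "complex ^ 'm ^ 'm \<Rightarrow> complex ^ 'm ^ 'm"
  assumes P: "P \<in> cproj" and Y: "\<And>Q. Q \<in> cproj \<Longrightarrow> Y Q \<in> tangent Q"
    and diff: "Y differentiable (at P)" and u: "u \<in> tangent P"
  shows "frechet_derivative Y (at P) u
    = tan_proj' P u (Y P) + tan_proj P (frechet_derivative Y (at P) u)"
proof -
  obtain z where z: "norm z = 1" "P = hpoint z" using cproj_unitE[OF P] .
  then obtain w where w: "hinner z w = 0" "u = hlift z w"
    using u tangent_hpoint[OF z(1)] by auto
  obtain \<gamma> where g: "\<gamma> 0 = P" "\<And>s. \<gamma> s \<in> cproj"
    "(\<gamma> has_derivative (\<lambda>h. h *\<^sub>R u)) (at (0::real))"
    using tangent_hpoint_curve[OF z(1) w(1)] unfolding has_vector_derivative_def z(2) w(2) by blast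
  let ?D = "frechet_derivative Y (at P)"
  have "(Y has_derivative ?D) (at (\<gamma> 0))"
    using diff g(1) by (simp add: frechet_derivative_works)
  from diff_chain_at[OF g(3) this]
  have Yg: "((\<lambda>s. Y (\<gamma> s)) has_derivative (\<lambda>h. ?D (h *\<^sub>R u))) (at 0)"
    by (simp add: o_def)
  have "((\<lambda>s. tan_proj (\<gamma> s) (Y (\<gamma> s))) has_derivative
      (\<lambda>h. tan_proj' P (h *\<^sub>R u) (Y P) + tan_proj P (?D (h *\<^sub>R u)))) (at 0)"
    using has_derivative_tan_proj[OF g(3) Yg] by (simp add: g(1))
  moreover have "(\<lambda>s. tan_proj (\<gamma> s) (Y (\<gamma> s))) = (\<lambda>s. Y (\<gamma> s))"
    using g(2) Y by (simp add: tan_proj_tangent)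
  ultimately have "(\<lambda>h. tan_proj' P (h *\<^sub>R u) (Y P) + tan_proj P (?D (h *\<^sub>R u)))
      = (\<lambda>h. ?D (h *\<^sub>R u))"
    using has_derivative_unique[OF _ Yg] by simp
  from fun_cong[OF this, of 1] show ?thesis by simp
qed

lemma nabla_torsion_free:
  assumes P: "P \<in> cproj"
    and X: "\<And>Q. Q \<in> cproj \<Longrightarrow> X Q \<in> tangent Q" and Y: "\<And>Q. Q \<in> cproj \<Longrightarrow> Y Q \<in> tangent Q"
    and "X differentiable (at P)" "Y differentiable (at P)"
  shows "nabla X Y P - nabla Y X P = lie_bracket X Y P"
proof -
  note move = tangent_move(1,2)[OF P] tangent_move(3,4)[OF P X[OF P]] tangent_move(3,4)[OF P Y[OF P]]
  have "tan_proj' P (X P) (Y P) = tan_proj' P (Y P) (X P)"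
    unfolding tan_proj'_def scaleR_2 by (simp only: mm_simps move) simp
  moreover note derivative_tangent_field[OF P Y assms(5) X[OF P]]
  moreover note derivative_tangent_field[OF P X assms(4) Y[OF P]]
  ultimately have "lie_bracket X Y P
    = (tan_proj' P (X P) (Y P) + nabla X Y P) - (tan_proj' P (X P) (Y P) + nabla Y X P)"
    unfolding nabla_def lie_bracket_def by simp
  then show ?thesis by simp
qed

lemma holomorphic_sectional_curvature:
  assumes P: "P \<in> cproj" and X: "X \<in> tangent P" and n: "fs_metric X X = 1"
  shows "fs_metric (riemann P X (cstruct P X) (cstruct P X)) X = 4"
proof -
  obtain z where z: "norm z = 1" "P = hpoint z" using cproj_unitE[OF P] .
  then obtain w where w: "hinner z w = 0" "X = hlift z w"
    using X tangent_hpoint[OF z(1)] by auto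
  have "cnj (hinner z w) = 0" using w by simp
  then have wz: "hinner w z = 0" by (simp add: hinner_def mult.commute)
  have zz: "hinner z z = 1" using z by (simp add: hinner_self)
  have "w \<bullet> w = 1" using n w z by (simp add: fs_metric_hopf)
  then have ww: "hinner w w = 1" by (simp add: hinner_self flip: power2_norm_eq_inner)
  have hi: "hinner a (\<i> *s b) = \<i> * hinner a b" "hinner (\<i> *s a) b = - \<i> * hinner a b"
    for a b :: "complex ^ 'a"
    by (simp_all add: hinner_def sum_distrib_left mult_ac sum_negf)
  note h = hi w(1) wz zz ww
  let ?Y = "hlift z (\<i> *s w)"
  have Y: "cstruct P X = ?Y" using z w by (simp add: cstruct_hopf)
  have YT: "?Y \<in> tangent P" using z(2) w(1) by (auto simp: tangent_hpoint[OF z(1)] hi)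
  have XY: "X ** ?Y - ?Y ** X = - 2 *\<^sub>R outer (\<i> *s w) w + 2 *\<^sub>R outer (\<i> *s z) z"
    by (simp add: w(2) hlift_def mm_simps outer_mult h vec_eq_iff)
       (simp add: outer_def scaleR_conv_of_real algebra_simps)
  have "riemann P X ?Y ?Y = 4 *\<^sub>R X"
    unfolding riemann_eq[OF P X YT YT] XY
    by (simp add: w(2) hlift_def mm_simps outer_mult h vec_eq_iff)
       (simp add: outer_def scaleR_conv_of_real algebra_simps)
  then show ?thesis using n by (simp add: Y fs_metric_def)
qed

end

theory Submission
  imports Defs
begin

text \<open>
  Write \<open>J\<close> for the complex structure and extend the frame and the curvatures by zero beyond the
  osculating order.  The tension field of a Frenet curve is \<open>k\<^sub>1 E\<^sub>2\<close>.  The curvature of the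
  Fubini-Study metric satisfies \<open>R(u, v) u = \<langle>u, v\<rangle> u - \<langle>u, u\<rangle> v + 3 \<langle>u, J v\<rangle> J u\<close>
  (\<open>riemann_jacobi\<close>), so the Frenet equations give the bitension field (\<open>bitension_F\<close>)

  \<open>- 3 k\<^sub>1 k\<^sub>1' E\<^sub>1 + (k\<^sub>1'' - k\<^sub>1\<^sup>3 - k\<^sub>1 k\<^sub>2\<^sup>2 + k\<^sub>1) E\<^sub>2 + (2 k\<^sub>1' k\<^sub>2 + k\<^sub>1 k\<^sub>2') E\<^sub>3 + k\<^sub>1 k\<^sub>2 k\<^sub>3 E\<^sub>4
    - 3 k\<^sub>1 \<tau>\<^sub>1\<^sub>2 J E\<^sub>1\<close>.

  Let \<open>f\<^sub>i = \<langle>J E\<^sub>1, E\<^sub>i\<rangle>\<close>, so that \<open>f\<^sub>2 = - \<tau>\<^sub>1\<^sub>2\<close>, and suppose that the bitension vanishes.  Since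
  \<open>\<tau>\<^sub>1\<^sub>2 \<noteq> 0\<close>, the vector \<open>J E\<^sub>1\<close>, which is orthogonal to \<open>E\<^sub>1\<close>, is \<open>f\<^sub>2 E\<^sub>2 + f\<^sub>3 E\<^sub>3 + f\<^sub>4 E\<^sub>4\<close>, and the
  components of the bitension say that \<open>k\<^sub>1\<close> is constant and that \<open>k\<^sub>1\<^sup>2 + k\<^sub>2\<^sup>2 = 1 + 3 f\<^sub>2\<^sup>2\<close>,
  \<open>k\<^sub>2' = - 3 f\<^sub>2 f\<^sub>3\<close>, \<open>k\<^sub>2 k\<^sub>3 = - 3 f\<^sub>2 f\<^sub>4\<close> (\<open>biharmonic_components\<close>).  As \<open>J\<close> is parallel and skew
  (\<open>covD_cstruct\<close>, \<open>cstruct_isometry\<close>), \<open>f\<^sub>2' = k\<^sub>2 f\<^sub>3\<close>.  Differentiating the second relation and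
  comparing with the third forces \<open>f\<^sub>3 = 0\<close> (\<open>biharmonic_rigidity\<close>).  Hence \<open>f\<^sub>2\<^sup>2 + f\<^sub>4\<^sup>2 = 1\<close>, the
  functions \<open>f\<^sub>2\<close>, \<open>f\<^sub>4\<close>, \<open>k\<^sub>2\<close>, \<open>k\<^sub>3\<close> are constant, and \<open>f\<^sub>4 \<noteq> 0\<close> because \<open>\<tau>\<^sub>1\<^sub>2\<close> is not \<open>1\<close> or \<open>-1\<close>.
  The angle is defined by \<open>f\<^sub>2 = cos \<alpha>\<^sub>0\<close>, \<open>f\<^sub>4 = sin \<alpha>\<^sub>0\<close>; it lies in the second or the fourth
  quadrant because \<open>k\<^sub>2 k\<^sub>3\<close> is positive.

  Conversely, the stated relations make the coefficients of \<open>E\<^sub>2\<close> and \<open>E\<^sub>4\<close> in the bitension cancel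
  (\<open>bitension_zero_of_helix\<close>), and \<open>k\<^sub>1 > 0\<close> excludes harmonicity.
\<close>

section \<open>Smooth functions on an interval\<close>

abbreviation ddt :: "real set \<Rightarrow> (real \<Rightarrow> 'a::real_normed_vector) \<Rightarrow> real \<Rightarrow> 'a" where
  "ddt I f t \<equiv> vector_derivative f (at t within I)"

text \<open>
  Smoothness is filtered by the number of derivatives that exist, peeling off the innermost
  derivative instead of the outermost: the product rule expresses the first derivative of a product
  through products again, so closure under products follows by induction on this number.
\<close>

primrec times_diff :: "real set \<Rightarrow> nat \<Rightarrow> (real \<Rightarrow> 'a::real_normed_vector) \<Rightarrow> bool" where
  "times_diff I 0 f \<longleftrightarrow> f differentiable_on I"
| "times_diff I (Suc n) f \<longleftrightarrow>
     f differentiable_on I \<and> times_diff I n (ddt I f)"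

lemma iter_deriv_ddt: "iter_deriv I n (ddt I f) = iter_deriv I (Suc n) f"
  by (induction n) simp_all

lemma times_diff_Suc: "times_diff I (Suc n) f \<Longrightarrow> times_diff I n f"
  by (induction n arbitrary: f) auto

lemma smooth_on_iff: "smooth_on I f \<longleftrightarrow> (\<forall>n. times_diff I n f)"
proof
  assume "smooth_on I f"
  then show "\<forall>n. times_diff I n f"
  proof (intro allI)
    fix n assume "smooth_on I f" then show "times_diff I n f"
    proof (induction n arbitrary: f)
      case 0
      then show ?case unfolding smooth_on_def by (metis iter_deriv.simps(1) times_diff.simps(1))
    next
      case (Suc n)
      then have "smooth_on I (ddt I f)"
        unfolding smooth_on_def iter_deriv_ddt by blast
      then show ?case using Suc.IH[of "ddt I f"] Suc.prems
        unfolding smooth_on_def by (auto dest: spec[of _ 0])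
    qed
  qed
next
  assume *: "\<forall>n. times_diff I n f"
  have "times_diff I n f \<Longrightarrow> iter_deriv I n f differentiable_on I" for n
  proof (induction n arbitrary: f)
    case (Suc n)
    then show ?case using Suc.IH[of "ddt I f"] by (simp only: iter_deriv_ddt times_diff.simps)
  qed simp
  with * show "smooth_on I f" unfolding smooth_on_def by blast
qed

lemma smooth_on_ddt: "smooth_on I f \<Longrightarrow> smooth_on I (ddt I f)"
  unfolding smooth_on_iff by (metis times_diff.simps(2))

lemma smooth_on_differentiable: "smooth_on I f \<Longrightarrow> t \<in> I \<Longrightarrow> f differentiable (at t within I)"
  unfolding smooth_on_iff by (metis times_diff.simps(1) differentiable_on_def)

lemma smooth_on_has_ddt:
  "smooth_on I f \<Longrightarrow> t \<in> I \<Longrightarrow> (f has_vector_derivative ddt I f t) (at t within I)"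
  using smooth_on_differentiable vector_derivative_works by blast

lemma ddt_cong:
  assumes "t \<in> I" "\<And>s. s \<in> I \<Longrightarrow> f s = g s"
  shows "ddt I f t = ddt I g t"
proof -
  have "(f has_vector_derivative D) (at t within I) \<longleftrightarrow> (g has_vector_derivative D) (at t within I)" for D
    using assms by (metis has_vector_derivative_transform)
  then show ?thesis by (simp add: vector_derivative_def)
qed

lemma differentiable_on_cong:
  assumes "\<And>t. t \<in> I \<Longrightarrow> f t = g t" "f differentiable_on I"
  shows "g differentiable_on I"
  using assms unfolding differentiable_on_def differentiable_def
  by (metis has_derivative_transform)

lemma times_diff_cong:
  assumes "\<And>t. t \<in> I \<Longrightarrow> f t = g t" "times_diff I n f"
  shows "times_diff I n g"
  using assms
proof (induction n arbitrary: f g)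
  case 0
  then show ?case by (metis differentiable_on_cong times_diff.simps(1))
next
  case (Suc n)
  have "times_diff I n (ddt I g)"
    using Suc.IH[of "ddt I f" "ddt I g"] Suc.prems ddt_cong[of _ I f g] by simp
  moreover have "g differentiable_on I"
    using Suc.prems by (metis differentiable_on_cong times_diff.simps(2))
  ultimately show ?case by simp
qed

lemma smooth_on_cong: "(\<And>t. t \<in> I \<Longrightarrow> f t = g t) \<Longrightarrow> smooth_on I f \<Longrightarrow> smooth_on I g"
  unfolding smooth_on_iff using times_diff_cong by blast

text \<open>
  Every point of a nondegenerate interval is a limit point of it, end points included, so that
  derivatives within the interval are unique.
\<close>

lemma at_within_nondegenerate:
  fixes I :: "real set"
  assumes "is_interval I" "interior I \<noteq> {}" "t \<in> I"
  shows "at t within I \<noteq> bot"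
proof -
  have "closure (interior I) = closure I"
    using assms by (simp add: convex_closure_interior is_interval_convex)
  moreover have "connected I" using assms(1) by (simp add: is_interval_connected)
  moreover have "\<not> (\<exists>a. I \<subseteq> {a})"
    using assms(2) interior_mono by (metis interior_singleton subset_empty)
  then have "I \<noteq> {t}" by blast
  ultimately have "t islimpt I" using assms(3) by (intro connected_imp_perfect) auto
  then show ?thesis by (simp add: trivial_limit_within)
qed

locale nondegenerate_interval =
  fixes I :: "real set"
  assumes interval: "is_interval I" and interior_nonempty: "interior I \<noteq> {}"
begin

lemma ddt_eqI: "(f has_vector_derivative D) (at t within I) \<Longrightarrow> t \<in> I \<Longrightarrow> ddt I f t = D"
  using at_within_nondegenerate[OF interval interior_nonempty] vector_derivative_within by blast

lemma times_diff_add: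
  assumes "times_diff I n f" "times_diff I n g"
  shows "times_diff I n (\<lambda>t. f t + g t)"
  using assms
proof (induction n arbitrary: f g)
  case 0
  then show ?case by (simp add: differentiable_on_add)
next
  case (Suc n)
  have "ddt I (\<lambda>s. f s + g s) t = ddt I f t + ddt I g t" if "t \<in> I" for t
    using Suc.prems that
    by (intro ddt_eqI has_vector_derivative_add)
       (auto simp: differentiable_on_def simp flip: vector_derivative_works)
  then show ?case
    using Suc times_diff_cong[of I "\<lambda>t. ddt I f t + ddt I g t" "ddt I (\<lambda>s. f s + g s)" n]
    by (simp add: differentiable_on_add)
qed

lemma differentiable_on_bilinear:
  assumes "bounded_bilinear B" "f differentiable_on I" "g differentiable_on I"
  shows "(\<lambda>t. B (f t) (g t)) differentiable_on I"
  using assms(2,3) bounded_bilinear.FDERIV[OF assms(1)]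
  unfolding differentiable_on_def differentiable_def by blast

lemma times_diff_bilinear:
  assumes B: "bounded_bilinear B" and "times_diff I n f" "times_diff I n g"
  shows "times_diff I n (\<lambda>t. B (f t) (g t))"
  using assms(2,3)
proof (induction n arbitrary: f g)
  case 0
  then show ?case
    by (simp add: differentiable_on_bilinear[OF B])
next
  case (Suc n)
  have diff: "f differentiable_on I" "g differentiable_on I" using Suc.prems by simp_all
  have lower: "times_diff I n f" "times_diff I n g"
    using Suc.prems by (blast intro: times_diff_Suc)+
  have "ddt I (\<lambda>s. B (f s) (g s)) t = B (f t) (ddt I g t) + B (ddt I f t) (g t)" if "t \<in> I" for t
    using diff that
    by (intro ddt_eqI bounded_bilinear.has_vector_derivative[OF B])
       (auto simp: differentiable_on_def simp flip: vector_derivative_works)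
  moreover have "times_diff I n (\<lambda>t. B (f t) (ddt I g t) + B (ddt I f t) (g t))"
    using Suc.prems by (intro times_diff_add Suc.IH lower) simp_all
  ultimately have "times_diff I n (ddt I (\<lambda>s. B (f s) (g s)))"
    using times_diff_cong[of I "\<lambda>t. B (f t) (ddt I g t) + B (ddt I f t) (g t)"] by simp
  moreover have "(\<lambda>s. B (f s) (g s)) differentiable_on I"
    using diff by (rule differentiable_on_bilinear[OF B])
  ultimately show ?case by simp
qed

lemma smooth_on_add: "smooth_on I f \<Longrightarrow> smooth_on I g \<Longrightarrow> smooth_on I (\<lambda>t. f t + g t)"
  unfolding smooth_on_iff using times_diff_add by blast

lemma smooth_on_bilinear:
  "bounded_bilinear B \<Longrightarrow> smooth_on I f \<Longrightarrow> smooth_on I g \<Longrightarrow> smooth_on I (\<lambda>t. B (f t) (g t))"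
  unfolding smooth_on_iff using times_diff_bilinear by blast

lemma smooth_on_const: "smooth_on I (\<lambda>t. c)"
proof -
  have "times_diff I n (\<lambda>t. c)" for n and c :: 'a
  proof (induction n arbitrary: c)
    case (Suc n)
    have "ddt I (\<lambda>t. c) t = 0" if "t \<in> I" for t
      using that by (intro ddt_eqI) (auto intro: derivative_eq_intros)
    then show ?case
      using Suc[of 0] times_diff_cong[of I "\<lambda>t. 0" "ddt I (\<lambda>t. c)"] by simp
  qed simp
  then show ?thesis unfolding smooth_on_iff by blast
qed

lemma constant_of_ddt_0:
  fixes f :: "real \<Rightarrow> real"
  assumes "smooth_on I f" "\<And>t. t \<in> I \<Longrightarrow> ddt I f t = 0"
  obtains c where "\<And>t. t \<in> I \<Longrightarrow> f t = c"
proof -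
  have "\<And>t. t \<in> I \<Longrightarrow> (f has_vector_derivative 0) (at t within I)"
    using smooth_on_has_ddt[OF assms(1)] assms(2) by metis
  from has_vector_derivative_zero_constant[OF is_interval_convex[OF interval] this]
  show ?thesis using that by metis
qed

end

section \<open>Curvature and complex structure\<close>

lemma tangent_hlift:
  assumes "P \<in> cproj"
  obtains z where "norm z = 1" "P = hpoint z" "tangent P = hlift z ` {w. hinner z w = 0}"
  using assms cproj_unitE tangent_hpoint by metis

lemma hinner_scale_right: "hinner a (c *s b) = c * hinner a b"
  by (simp add: hinner_def sum_distrib_left mult_ac)

lemma hinner_scale_left: "hinner (c *s a) b = cnj c * hinner a b"
  by (simp add: hinner_def sum_distrib_left mult_ac)

lemma hinner_cnj: "cnj (hinner a b) = hinner b a"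
  by (simp add: hinner_def mult.commute)

lemma cstruct_tangent:
  assumes P: "P \<in> cproj" and "X \<in> tangent P"
  shows "cstruct P X \<in> tangent P"
proof -
  obtain z where z: "norm z = 1" "P = hpoint z" "tangent P = hlift z ` {w. hinner z w = 0}"
    using tangent_hlift[OF P] .
  then obtain w where w: "hinner z w = 0" "X = hlift z w" using assms by auto
  then show ?thesis using z by (auto simp: cstruct_hopf hinner_scale_right)
qed

text \<open>
  On horizontal lifts the complex structure is multiplication by \<open>\<i>\<close>, a skew isometry.
\<close>

lemma cstruct_isometry:
  assumes P: "P \<in> cproj" and "X \<in> tangent P" "Y \<in> tangent P"
  shows "fs_metric (cstruct P X) (cstruct P Y) = fs_metric X Y"
    and "fs_metric (cstruct P X) Y = - fs_metric X (cstruct P Y)"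
proof -
  obtain z where z: "norm z = 1" "P = hpoint z" "tangent P = hlift z ` {w. hinner z w = 0}"
    using tangent_hlift[OF P] .
  then obtain v w where w: "hinner z v = 0" "X = hlift z v" "hinner z w = 0" "Y = hlift z w"
    using assms by auto
  show "fs_metric (cstruct P X) (cstruct P Y) = fs_metric X Y"
    "fs_metric (cstruct P X) Y = - fs_metric X (cstruct P Y)"
    using z w by (simp_all add: cstruct_hopf hinner_scale_right hinner_scale_left fs_metric_hopf flip: Re_hinner)
qed

text \<open>
  The case of the curvature of constant holomorphic sectional curvature \<open>4\<close> that enters the
  bitension.  In horizontal lifts \<open>a\<close>, \<open>b\<close> of \<open>u\<close>, \<open>v\<close> with \<open>hinner a b = p + \<i> s\<close> everything is
  a combination of rank-one matrices: the commutator of \<open>u\<close> and \<open>v\<close> is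
  \<open>a b\<^sup>* - b a\<^sup>* + 2 \<i> s z z\<^sup>*\<close>, and its commutator with \<open>u\<close> leaves
  \<open>p u - |a|\<^sup>2 v - 3 s J u\<close>, where \<open>s = - fs_metric u (J v)\<close>.
\<close>

lemma riemann_jacobi:
  assumes P: "P \<in> cproj" and u: "u \<in> tangent P" and v: "v \<in> tangent P"
  shows "riemann P u v u = fs_metric u v *\<^sub>R u - fs_metric u u *\<^sub>R v
    + (3 * fs_metric u (cstruct P v)) *\<^sub>R cstruct P u"
proof -
  obtain z where z: "norm z = 1" "P = hpoint z" "tangent P = hlift z ` {w. hinner z w = 0}"
    using tangent_hlift[OF P] .
  then obtain a b where a: "hinner z a = 0" "u = hlift z a" and b: "hinner z b = 0" "v = hlift z b"
    using u v by auto
  have zz: "hinner z z = 1" using z by (simp add: hinner_self)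
  have az: "hinner a z = 0" "hinner b z = 0" using a b by (metis hinner_cnj complex_cnj_zero)+
  obtain p s where ps: "hinner a b = Complex p s" by (metis complex.exhaust)
  then have ba: "hinner b a = Complex p (- s)" by (metis hinner_cnj complex_cnj)
  define q where "q = a \<bullet> a"
  have aa: "hinner a a = of_real q" by (simp add: q_def hinner_self power2_norm_eq_inner)
  have fs: "fs_metric u v = p" "fs_metric u u = q" "fs_metric u (cstruct P v) = - s"
    using a b z aa by (simp_all add: cstruct_hopf fs_metric_hopf hinner_scale_right q_def ps flip: Re_hinner)
  note h = a(1) b(1) az zz ps ba aa
  have c: "cstruct P u = hlift z (\<i> *s a)" using a z by (simp add: cstruct_hopf)
  have cp: "Complex p s = of_real p + \<i> * of_real s" for p s by (simp add: complex_eq_iff)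
  have com: "u ** v - v ** u = outer a b - outer b a + (2 * s) *\<^sub>R outer (\<i> *s z) z"
    by (simp add: a(2) b(2) hlift_def mm_simps outer_mult h vec_eq_iff)
       (simp add: outer_def scaleR_conv_of_real algebra_simps cp)
  show ?thesis
    unfolding riemann_eq[OF P u v u] com fs c
    by (simp add: a(2) b(2) hlift_def mm_simps outer_mult h hinner_scale_right hinner_scale_left vec_eq_iff)
       (simp add: outer_def scaleR_conv_of_real algebra_simps cp)
qed

section \<open>Covariant derivatives along a curve\<close>

lemma fs_metric_bounded_bilinear: "bounded_bilinear fs_metric"
  using bounded_bilinear.comp[OF bounded_bilinear_inner bounded_linear_ident
      bounded_linear_scaleR_right[of "1 / 2"]]
  by (simp add: fs_metric_def[abs_def])

interpretation fs: bounded_bilinear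
  "fs_metric :: complex ^ 'm ^ 'm \<Rightarrow> complex ^ 'm ^ 'm \<Rightarrow> real"
  by (rule fs_metric_bounded_bilinear)

lemma fs_metric_commute: "fs_metric X Y = fs_metric Y X"
  by (simp add: fs_metric_def inner_commute)

lemma tan_proj_linear:
  "tan_proj P (A + B) = tan_proj P A + tan_proj P B" "tan_proj P (A - B) = tan_proj P A - tan_proj P B"
  "tan_proj P (r *\<^sub>R A) = r *\<^sub>R tan_proj P A"
  "tan_proj P 0 = 0"
  by (simp_all add: tan_proj_def mm_simps mm.zero_left mm.zero_right algebra_simps)

text \<open>
  Entrywise multiplication by \<open>\<i>\<close>, through which the complex structure becomes \<open>\<i>\<close> times a
  commutator, so that the product rule for matrices applies to it.
\<close>

definition imult :: "complex ^ 'm ^ 'm \<Rightarrow> complex ^ 'm ^ 'm" where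
  "imult A = (\<chi> i j. \<i> * A $ i $ j)"

lemma bounded_linear_imult: "bounded_linear (imult :: complex ^ 'm ^ 'm \<Rightarrow> complex ^ 'm ^ 'm)"
  by (intro linear_conv_bounded_linear[THEN iffD1])
     (simp add: linear_iff imult_def vec_eq_iff algebra_simps)

lemma imult_mult: "A ** imult B = imult (A ** B)" "imult A ** B = imult (A ** B)"
  by (simp_all add: imult_def matrix_matrix_mult_def vec_eq_iff sum_distrib_left mult_ac)

lemma cstruct_imult: "cstruct P X = imult (X ** P - P ** X)"
  by (simp add: cstruct_def imult_def vec_eq_iff)

lemma tan_proj_imult: "tan_proj P (imult A) = imult (tan_proj P A)"
proof -
  interpret bounded_linear imult by (rule bounded_linear_imult)
  show ?thesis by (simp add: tan_proj_def imult_mult add diff scaleR)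
qed

lemma tan_proj_commutator:
  assumes P: "P \<in> cproj"
  shows "tan_proj P (A ** P - P ** A) = tan_proj P A ** P - P ** tan_proj P A"
  unfolding tan_proj_def scaleR_2 by (simp only: mm_simps tangent_move(1,2)[OF P]) simp

text \<open>
  A product of two tangent vectors at \<open>P\<close> commutes with \<open>P\<close>, and a matrix commuting with \<open>P\<close> is
  normal to the submanifold.
\<close>

lemma tan_proj_tangent_commutator:
  assumes P: "P \<in> cproj" and X: "X \<in> tangent P" and Y: "Y \<in> tangent P"
  shows "tan_proj P (X ** Y - Y ** X) = 0"
  unfolding tan_proj_def scaleR_2
  by (simp only: mm_simps tangent_move(1,2)[OF P] tangent_move(3,4)[OF P X]
    tangent_move(3,4)[OF P Y]) simp

lemma covD_cong:
  assumes "t \<in> I" "\<And>s. s \<in> I \<Longrightarrow> V s = W s"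
  shows "covD I \<gamma> V t = covD I \<gamma> W t"
  using ddt_cong[OF assms] by (simp add: covD_def)

context nondegenerate_interval
begin

lemma smooth_on_mult:
  fixes f g :: "real \<Rightarrow> real"
  shows "smooth_on I f \<Longrightarrow> smooth_on I g \<Longrightarrow> smooth_on I (\<lambda>t. f t * g t)"
  by (rule smooth_on_bilinear[OF bounded_bilinear_mult])

lemma smooth_on_scaleR: "smooth_on I f \<Longrightarrow> smooth_on I V \<Longrightarrow> smooth_on I (\<lambda>t. f t *\<^sub>R V t)"
  by (rule smooth_on_bilinear[OF bounded_bilinear_scaleR])

lemma smooth_on_linear:
  assumes "bounded_linear L" "smooth_on I V"
  shows "smooth_on I (\<lambda>t. L (V t))"
proof -
  have "bounded_bilinear (\<lambda>(r::real) x. r *\<^sub>R L x)"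
    by (rule bounded_bilinear.comp[OF bounded_bilinear_scaleR bounded_linear_ident assms(1)])
  from smooth_on_bilinear[OF this smooth_on_const[of 1] assms(2)] show ?thesis by simp
qed

lemma smooth_on_minus: "smooth_on I V \<Longrightarrow> smooth_on I (\<lambda>t. - V t)"
  by (rule smooth_on_linear[OF bounded_linear_minus[OF bounded_linear_ident]])

lemma smooth_on_diff: "smooth_on I V \<Longrightarrow> smooth_on I W \<Longrightarrow> smooth_on I (\<lambda>t. V t - W t)"
  using smooth_on_add[OF _ smooth_on_minus] by fastforce

lemma ddt_mult:
  fixes f g :: "real \<Rightarrow> real"
  assumes "smooth_on I f" "smooth_on I g" "t \<in> I"
  shows "ddt I (\<lambda>s. f s * g s) t = f t * ddt I g t + ddt I f t * g t"
  by (intro ddt_eqI has_vector_derivative_mult smooth_on_has_ddt assms)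

lemma has_ddt_square:
  fixes f :: "real \<Rightarrow> real"
  assumes "smooth_on I f" "t \<in> I"
  shows "((\<lambda>s. (f s)\<^sup>2) has_vector_derivative 2 * f t * ddt I f t) (at t within I)"
  using has_vector_derivative_mult[OF smooth_on_has_ddt[OF assms] smooth_on_has_ddt[OF assms]]
  by (simp add: power2_eq_square mult_ac)

lemma smooth_covD:
  assumes "smooth_on I \<gamma>" "smooth_on I V"
  shows "smooth_on I (covD I \<gamma> V)"
  unfolding covD_def[abs_def] tan_proj_def
  by (intro smooth_on_diff smooth_on_add smooth_on_scaleR smooth_on_const
      smooth_on_bilinear[OF matrix_mult_bounded_bilinear] smooth_on_ddt assms)

lemma smooth_cstruct:
  assumes "smooth_on I \<gamma>" "smooth_on I V"
  shows "smooth_on I (\<lambda>t. cstruct (\<gamma> t) (V t))"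
  unfolding cstruct_imult
  by (intro smooth_on_linear[OF bounded_linear_imult] smooth_on_diff
      smooth_on_bilinear[OF matrix_mult_bounded_bilinear] assms)

lemma covD_add:
  assumes "smooth_on I V" "smooth_on I W" "t \<in> I"
  shows "covD I \<gamma> (\<lambda>s. V s + W s) t = covD I \<gamma> V t + covD I \<gamma> W t"
  unfolding covD_def tan_proj_linear(1)[symmetric]
  by (intro arg_cong[where f = "tan_proj _"] ddt_eqI has_vector_derivative_add smooth_on_has_ddt assms)

lemma covD_diff:
  assumes "smooth_on I V" "smooth_on I W" "t \<in> I"
  shows "covD I \<gamma> (\<lambda>s. V s - W s) t = covD I \<gamma> V t - covD I \<gamma> W t"
  unfolding covD_def tan_proj_linear(2)[symmetric]
  by (intro arg_cong[where f = "tan_proj _"] ddt_eqI has_vector_derivative_diff smooth_on_has_ddt assms)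

lemma covD_scaleR:
  assumes "smooth_on I f" "smooth_on I V" "t \<in> I" "\<gamma> t \<in> cproj" "V t \<in> tangent (\<gamma> t)"
  shows "covD I \<gamma> (\<lambda>s. f s *\<^sub>R V s) t = f t *\<^sub>R covD I \<gamma> V t + ddt I f t *\<^sub>R V t"
proof -
  have "ddt I (\<lambda>s. f s *\<^sub>R V s) t = f t *\<^sub>R ddt I V t + ddt I f t *\<^sub>R V t"
    by (intro ddt_eqI bounded_bilinear.has_vector_derivative[OF bounded_bilinear_scaleR]
        smooth_on_has_ddt assms)
  then show ?thesis using assms(4,5) by (simp add: covD_def tan_proj_linear tan_proj_tangent)
qed

lemma covD_zero: "t \<in> I \<Longrightarrow> covD I \<gamma> (\<lambda>s. 0) t = 0"
  by (subst covD_def, subst ddt_eqI[of _ 0]) (auto simp: tan_proj_linear)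

text \<open>
  The metric is Kaehler: in the ambient derivative of \<open>J V\<close> the variation of \<open>J\<close> along the curve
  contributes \<open>\<i>\<close> times a commutator of tangent vectors, which is normal.
\<close>

lemma covD_cstruct:
  assumes "smooth_on I \<gamma>" "smooth_on I V" "t \<in> I" "\<gamma> t \<in> cproj"
    "V t \<in> tangent (\<gamma> t)" "velocity I \<gamma> t \<in> tangent (\<gamma> t)"
  shows "covD I \<gamma> (\<lambda>s. cstruct (\<gamma> s) (V s)) t = cstruct (\<gamma> t) (covD I \<gamma> V t)"
proof -
  let ?T = "velocity I \<gamma> t" and ?V = "ddt I V t"
  have "ddt I (\<lambda>s. cstruct (\<gamma> s) (V s)) t
      = imult ((V t ** ?T + ?V ** \<gamma> t) - (\<gamma> t ** ?V + ?T ** V t))"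
    unfolding cstruct_imult velocity_def
    by (intro ddt_eqI bounded_linear.has_vector_derivative[OF bounded_linear_imult]
        has_vector_derivative_diff mm.has_vector_derivative smooth_on_has_ddt assms)
  also have "\<dots> = imult ((?V ** \<gamma> t - \<gamma> t ** ?V) + (V t ** ?T - ?T ** V t))"
    by (simp add: algebra_simps)
  finally show ?thesis
    by (simp add: covD_def tan_proj_imult tan_proj_linear(1) tan_proj_commutator
        tan_proj_tangent_commutator assms cstruct_imult)
qed

end

section \<open>The bitension field in the Frenet frame\<close>

locale frenet =
  fixes I :: "real set" and \<gamma> :: "real \<Rightarrow> complex ^ 'm ^ 'm" and d :: nat
    and E :: "nat \<Rightarrow> real \<Rightarrow> complex ^ 'm ^ 'm" and k :: "nat \<Rightarrow> real \<Rightarrow> real"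
  assumes frenet: "frenet_curve I \<gamma> d E k"

sublocale frenet \<subseteq> nondegenerate_interval I
  using frenet by unfold_locales (simp_all add: frenet_curve_def)

context frenet
begin

text \<open>
  The Frenet frame and the curvatures are extended by zero beyond the osculating order (and to the
  index \<open>0\<close>).  The Frenet equations then have one form for all indices, see \<open>covD_F\<close>, and the
  computation of the bitension needs no distinction of small osculating orders.
\<close>

definition F :: "nat \<Rightarrow> real \<Rightarrow> complex ^ 'm ^ 'm" where
  "F i t = (if i \<in> {1..d} then E i t else 0)"

definition K :: "nat \<Rightarrow> real \<Rightarrow> real" where
  "K i t = (if i \<in> {1..<d} then k i t else 0)"

lemma curve: "smooth_on I \<gamma>" "t \<in> I \<Longrightarrow> \<gamma> t \<in> cproj"
  using frenet by (simp_all add: frenet_curve_def)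

lemma F_tangent: "t \<in> I \<Longrightarrow> F i t \<in> tangent (\<gamma> t)"
  using frenet by (auto simp: frenet_curve_def F_def tangent_def hadj_def vec_eq_iff mm.zero_left mm.zero_right)

lemma F_metric: "t \<in> I \<Longrightarrow> fs_metric (F i t) (F j t) = (if i = j \<and> i \<in> {1..d} then 1 else 0)"
  using frenet by (auto simp: frenet_curve_def F_def fs.zero_left fs.zero_right)

lemma F_smooth: "smooth_on I (F i)"
proof (cases "i \<in> {1..d}")
  case True
  then have "F i = E i" by (auto simp: F_def)
  then show ?thesis using True frenet by (simp add: frenet_curve_def)
next
  case False
  then have "F i = (\<lambda>t. 0)" by (auto simp: F_def)
  then show ?thesis by (simp add: smooth_on_const)
qed

lemma covD_F:
  assumes "t \<in> I"
  shows "covD I \<gamma> (F i) t = K i t *\<^sub>R F (Suc i) t - K (i - 1) t *\<^sub>R F (i - 1) t"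
proof (cases "i \<in> {1..d}")
  case True
  then have "F i = E i" by (auto simp: F_def)
  moreover have "covD I \<gamma> (E i) t =
        (if i = 1 then 0 else - (k (i - 1) t *\<^sub>R E (i - 1) t)) +
        (if i = d then 0 else k i t *\<^sub>R E (i + 1) t)"
    using True frenet assms unfolding frenet_curve_def by blast
  ultimately show ?thesis using True by (auto simp: F_def K_def)
next
  case False
  then have "F i = (\<lambda>t. 0)" by (auto simp: F_def)
  then show ?thesis using assms False by (auto simp: covD_zero F_def K_def)
qed

text \<open>
  The curvatures inherit smoothness from the frame, being the components
  \<open>fs_metric (covD I \<gamma> (F i)) (F (i + 1))\<close>.
\<close>

lemma K_smooth: "smooth_on I (K i)"
proof (rule smooth_on_cong)
  show "smooth_on I (\<lambda>t. fs_metric (covD I \<gamma> (F i) t) (F (Suc i) t))"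
    by (intro smooth_on_bilinear[OF fs_metric_bounded_bilinear] smooth_covD F_smooth curve)
  show "fs_metric (covD I \<gamma> (F i) t) (F (Suc i) t) = K i t" if "t \<in> I" for t
    using that by (simp add: covD_F fs.diff_left fs.scaleR_left F_metric) (auto simp: K_def)
qed

lemma F_1: "t \<in> I \<Longrightarrow> F 1 t = velocity I \<gamma> t"
  using frenet by (auto simp: frenet_curve_def F_def)

lemma tension_F: "t \<in> I \<Longrightarrow> tension I \<gamma> t = K 1 t *\<^sub>R F 2 t"
  using covD_cong[of t I "velocity I \<gamma>" "F 1" \<gamma>] F_1 covD_F[of t 1]
  by (simp add: tension_def K_def numeral_2_eq_2)

lemma covD_tension:
  assumes t: "t \<in> I"
  shows "covD I \<gamma> (tension I \<gamma>) t
    = (K 1 t * K 2 t) *\<^sub>R F 3 t - (K 1 t * K 1 t) *\<^sub>R F 1 t + ddt I (K 1) t *\<^sub>R F 2 t"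
proof -
  have "covD I \<gamma> (tension I \<gamma>) t = covD I \<gamma> (\<lambda>s. K 1 s *\<^sub>R F 2 s) t"
    using t by (intro covD_cong tension_F)
  then show ?thesis using t covD_F[OF t, of 2]
    by (simp add: covD_scaleR K_smooth F_smooth curve F_tangent algebra_simps numeral_3_eq_3)
qed

text \<open>
  Two applications of the Frenet equations to \<open>K 1 F 2\<close> give the terms in the frame; the curvature
  contributes \<open>K 1 F 2\<close> and the multiple of \<open>J (F 1)\<close>.
\<close>

lemma bitension_F:
  assumes t: "t \<in> I"
  shows "bitension I \<gamma> t = (- 3 * K 1 t * ddt I (K 1) t) *\<^sub>R F 1 t
    + (ddt I (ddt I (K 1)) t - K 1 t ^ 3 - K 1 t * (K 2 t)\<^sup>2 + K 1 t) *\<^sub>R F 2 t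
    + (2 * ddt I (K 1) t * K 2 t + K 1 t * ddt I (K 2) t) *\<^sub>R F 3 t
    + (K 1 t * K 2 t * K 3 t) *\<^sub>R F 4 t
    - (3 * K 1 t * fs_metric (F 1 t) (cstruct (\<gamma> t) (F 2 t))) *\<^sub>R cstruct (\<gamma> t) (F 1 t)"
proof -
  let ?J = "cstruct (\<gamma> t)"
  have d1: "1 \<in> {1..d}" using frenet by (simp add: frenet_curve_def)
  have "covD I \<gamma> (covD I \<gamma> (tension I \<gamma>)) t = covD I \<gamma> (\<lambda>s. (K 1 s * K 2 s) *\<^sub>R F 3 s
      - (K 1 s * K 1 s) *\<^sub>R F 1 s + ddt I (K 1) s *\<^sub>R F 2 s) t"
    using t by (intro covD_cong covD_tension)
  also have "\<dots> = (K 1 t * K 2 t) *\<^sub>R (K 3 t *\<^sub>R F 4 t - K 2 t *\<^sub>R F 2 t)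
      + (K 1 t * ddt I (K 2) t + ddt I (K 1) t * K 2 t) *\<^sub>R F 3 t
      - (K 1 t * K 1 t) *\<^sub>R (K 1 t *\<^sub>R F 2 t)
      - (2 * K 1 t * ddt I (K 1) t) *\<^sub>R F 1 t
      + ddt I (K 1) t *\<^sub>R (K 2 t *\<^sub>R F 3 t - K 1 t *\<^sub>R F 1 t)
      + ddt I (ddt I (K 1)) t *\<^sub>R F 2 t"
  proof -
    have c: "covD I \<gamma> (F 1) t = K 1 t *\<^sub>R F 2 t"
      "covD I \<gamma> (F 2) t = K 2 t *\<^sub>R F 3 t - K 1 t *\<^sub>R F 1 t"
      "covD I \<gamma> (F 3) t = K 3 t *\<^sub>R F 4 t - K 2 t *\<^sub>R F 2 t"
      using covD_F[OF t, of 1] covD_F[OF t, of 2] covD_F[OF t, of 3]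
      by (simp_all add: K_def eval_nat_numeral)
    show ?thesis
      using t by (simp add: covD_add covD_diff covD_scaleR smooth_on_add smooth_on_diff smooth_on_scaleR smooth_on_mult
          smooth_on_ddt K_smooth F_smooth curve F_tangent c[unfolded One_nat_def] ddt_mult)
  qed
  finally have 1: "covD I \<gamma> (covD I \<gamma> (tension I \<gamma>)) t = \<dots>" .
  have "riemann (\<gamma> t) (velocity I \<gamma> t) (tension I \<gamma> t) (velocity I \<gamma> t)
    = riemann (\<gamma> t) (F 1 t) (K 1 t *\<^sub>R F 2 t) (F 1 t)"
    using t F_1 tension_F by simp
  also have "\<dots> = - (K 1 t *\<^sub>R F 2 t) + (3 * K 1 t * fs_metric (F 1 t) (?J (F 2 t))) *\<^sub>R ?J (F 1 t)"
  proof -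
    have "K 1 t *\<^sub>R F 2 t \<in> tangent (\<gamma> t)"
      using F_tangent[OF t, of 2] by (simp add: tangent_def hadj_linear mm_simps flip: scaleR_add_right)
    moreover have "?J (K 1 t *\<^sub>R F 2 t) = K 1 t *\<^sub>R ?J (F 2 t)"
      by (simp add: cstruct_def vec_eq_iff mm_simps flip: scaleR_diff_right)
    ultimately show ?thesis
      using t d1 by (simp add: riemann_jacobi curve F_tangent fs.scaleR_right F_metric)
  qed
  finally have 2: "riemann (\<gamma> t) (velocity I \<gamma> t) (tension I \<gamma> t) (velocity I \<gamma> t) = \<dots>" .
  show ?thesis
    unfolding bitension_def rough_laplacian_def 1 2
    by (simp add: vec_eq_iff scaleR_conv_of_real algebra_simps power2_eq_square power3_eq_cube)
qed

text \<open>
  The component of \<open>J (F 1)\<close> along \<open>F i\<close>, that is \<open>- \<tau>\<^sub>1\<^sub>i\<close>.  With this sign the frame components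
  of \<open>J (F 1)\<close> appear directly, and \<open>tors 2\<close>, \<open>tors 4\<close> become \<open>cos \<alpha>\<^sub>0\<close>, \<open>sin \<alpha>\<^sub>0\<close>.
\<close>

definition tors :: "nat \<Rightarrow> real \<Rightarrow> real" where
  "tors i t = fs_metric (cstruct (\<gamma> t) (F 1 t)) (F i t)"

lemma tors_smooth: "smooth_on I (tors i)"
  unfolding tors_def[abs_def]
  by (intro smooth_on_bilinear[OF fs_metric_bounded_bilinear] smooth_cstruct F_smooth curve)

lemma skew: "t \<in> I \<Longrightarrow> fs_metric (cstruct (\<gamma> t) (F i t)) (F i t) = 0"
  using cstruct_isometry(2)[OF curve(2) F_tangent F_tangent, of t i i]
    fs_metric_commute[of "F i t"] by simp

lemma ddt_tors:
  assumes t: "t \<in> I"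
  shows "ddt I (tors i) t = K 1 t * fs_metric (cstruct (\<gamma> t) (F 2 t)) (F i t)
    + K i t * tors (Suc i) t - K (i - 1) t * tors (i - 1) t"
proof -
  let ?J = "cstruct (\<gamma> t)"
  have "ddt I (tors i) t = fs_metric (covD I \<gamma> (\<lambda>s. cstruct (\<gamma> s) (F 1 s)) t) (F i t)
      + fs_metric (?J (F 1 t)) (covD I \<gamma> (F i) t)"
    unfolding tors_def[abs_def] using t
    by (intro ddt_eqI covD_metric smooth_on_differentiable[of I] smooth_cstruct cstruct_tangent
      F_smooth F_tangent curve)
  moreover have "covD I \<gamma> (\<lambda>s. cstruct (\<gamma> s) (F 1 s)) t = ?J (covD I \<gamma> (F 1) t)"
    using t F_tangent[OF t, of 1] F_1[OF t] by (intro covD_cstruct curve F_smooth) simp_all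
  moreover have "covD I \<gamma> (F 1) t = K 1 t *\<^sub>R F 2 t"
    using covD_F[OF t, of 1] by (simp add: K_def numeral_2_eq_2)
  moreover have "?J (K 1 t *\<^sub>R F 2 t) = K 1 t *\<^sub>R ?J (F 2 t)"
    by (simp add: cstruct_def vec_eq_iff mm_simps flip: scaleR_diff_right)
  ultimately show ?thesis
    by (simp add: covD_F[OF t] fs.diff_right fs.scaleR_right fs.scaleR_left tors_def)
qed

end

section \<open>Biharmonic Frenet curves\<close>

text \<open>
  The sign of \<open>cos \<alpha> sin \<alpha>\<close> decides the quadrants; it will be negative because the product
  \<open>K 2 K 3 = - 3 cos \<alpha> sin \<alpha>\<close> is positive.
\<close>

lemma second_or_fourth_quadrant:
  assumes "(x::real)\<^sup>2 + y\<^sup>2 = 1" "x * y < 0"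
  obtains \<alpha> where "\<alpha> \<in> {pi / 2 <..< pi} \<union> {3 * pi / 2 <..< 2 * pi}" "x = cos \<alpha>" "y = sin \<alpha>"
proof -
  obtain \<alpha> where a: "0 \<le> \<alpha>" "\<alpha> < 2 * pi" "x = cos \<alpha>" "y = sin \<alpha>"
    using sincos_total_2pi[OF assms(1)] by metis
  have "\<not> \<alpha> \<le> pi / 2"
  proof
    assume "\<alpha> \<le> pi / 2"
    then have "0 \<le> cos \<alpha>" "0 \<le> sin \<alpha>"
      using a(1) by (auto intro!: cos_ge_zero sin_ge_zero)
    then have "0 \<le> x * y" unfolding a(3,4) by (rule mult_nonneg_nonneg)
    with assms(2) show False by linarith
  qed
  moreover have "\<not> (pi \<le> \<alpha> \<and> \<alpha> \<le> 3 * pi / 2)"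
  proof
    assume "pi \<le> \<alpha> \<and> \<alpha> \<le> 3 * pi / 2"
    then have "0 \<le> cos (\<alpha> - pi)" "0 \<le> sin (\<alpha> - pi)"
      using cos_ge_zero[of "\<alpha> - pi"] sin_ge_zero[of "\<alpha> - pi"] pi_gt_zero by linarith+
    then have "x \<le> 0" "y \<le> 0" using a(3,4) by simp_all
    then have "0 \<le> x * y" by (rule mult_nonpos_nonpos)
    with assms(2) show False by linarith
  qed
  ultimately show ?thesis using a by (intro that[of \<alpha>]) auto
qed

context frenet
begin

lemma F_eq: "i \<in> {1..d} \<Longrightarrow> F i t = E i t"
  by (simp add: F_def)

lemma K_pos: "i \<in> {1..<d} \<Longrightarrow> t \<in> I \<Longrightarrow> K i t > 0"
  using frenet by (simp add: K_def frenet_curve_def)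

lemma d_pos: "1 \<le> d"
  using frenet by (simp add: frenet_curve_def)

lemma fs_F_cstruct: "t \<in> I \<Longrightarrow> fs_metric (F 1 t) (cstruct (\<gamma> t) (F i t)) = - tors i t"
  using cstruct_isometry(2)[OF curve(2) F_tangent F_tangent, of t 1 i] by (simp add: tors_def)

lemma tors_1: "t \<in> I \<Longrightarrow> tors 1 t = 0"
  using skew by (simp add: tors_def)

lemma tors_zero: "i > d \<Longrightarrow> tors i t = 0"
  by (simp add: tors_def F_def fs.zero_right)

text \<open>
  Pairing the vanishing bitension with the frame gives the scalar equations, divided by \<open>K 1\<close>
  where possible.  As the coefficient \<open>3 K 1 tors 2\<close> of \<open>J (F 1)\<close> does not vanish, the vector
  equation itself can be solved for \<open>J (F 1)\<close>, which places it in the span of the frame.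
\<close>

lemma biharmonic_components:
  assumes t: "t \<in> I" and "bitension I \<gamma> t = 0" "2 \<le> d" "tors 2 t \<noteq> 0"
  shows "ddt I (K 1) t = 0"
    and "ddt I (ddt I (K 1)) t - K 1 t ^ 3 - K 1 t * (K 2 t)\<^sup>2 + K 1 t + 3 * K 1 t * (tors 2 t)\<^sup>2 = 0"
    and "3 \<le> d \<Longrightarrow> ddt I (K 2) t = - 3 * tors 2 t * tors 3 t"
    and "4 \<le> d \<Longrightarrow> K 2 t * K 3 t = - 3 * tors 2 t * tors 4 t"
    and "cstruct (\<gamma> t) (F 1 t) = tors 2 t *\<^sub>R F 2 t + tors 3 t *\<^sub>R F 3 t + tors 4 t *\<^sub>R F 4 t"
proof -
  let ?J = "cstruct (\<gamma> t) (F 1 t)"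
  define a where "a = ddt I (ddt I (K 1)) t - K 1 t ^ 3 - K 1 t * (K 2 t)\<^sup>2 + K 1 t"
  define b where "b = 2 * ddt I (K 1) t * K 2 t + K 1 t * ddt I (K 2) t"
  define c where "c = K 1 t * K 2 t * K 3 t"
  define m where "m = 3 * K 1 t * tors 2 t"
  have k: "K 1 t > 0" using K_pos t assms by simp
  have bit: "(- 3 * K 1 t * ddt I (K 1) t) *\<^sub>R F 1 t + a *\<^sub>R F 2 t + b *\<^sub>R F 3 t + c *\<^sub>R F 4 t
      + m *\<^sub>R ?J = 0"
    using bitension_F[OF t] fs_F_cstruct[OF t, of 2] assms(2) by (simp add: a_def b_def c_def m_def)
  have "fs_metric ((- 3 * K 1 t * ddt I (K 1) t) *\<^sub>R F 1 t + a *\<^sub>R F 2 t + b *\<^sub>R F 3 t + c *\<^sub>R F 4 t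
      + m *\<^sub>R ?J) (F i t) = 0" for i
    unfolding bit by (simp add: fs.zero_left)
  then have pair: "(- 3 * K 1 t * ddt I (K 1) t) * fs_metric (F 1 t) (F i t)
      + a * fs_metric (F 2 t) (F i t) + b * fs_metric (F 3 t) (F i t) + c * fs_metric (F 4 t) (F i t)
      + m * tors i t = 0" for i
    by (simp add: fs.add_left fs.scaleR_left fs.diff_left fs.minus_left tors_def)
  show k1: "ddt I (K 1) t = 0"
    using pair[of 1] k tors_1[OF t] d_pos by (simp add: F_metric[OF t])
  have p2: "a + m * tors 2 t = 0"
    using pair[of 2] assms(3) by (simp add: F_metric[OF t])
  have p3: "b + m * tors 3 t = 0" if "3 \<le> d"
    using pair[of 3] that by (simp add: F_metric[OF t])
  have p4: "c + m * tors 4 t = 0" if "4 \<le> d"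
    using pair[of 4] that by (simp add: F_metric[OF t])
  show "ddt I (ddt I (K 1)) t - K 1 t ^ 3 - K 1 t * (K 2 t)\<^sup>2 + K 1 t + 3 * K 1 t * (tors 2 t)\<^sup>2 = 0"
    using p2 by (simp add: a_def m_def power2_eq_square)
  show "ddt I (K 2) t = - 3 * tors 2 t * tors 3 t" if "3 \<le> d"
  proof -
    have "K 1 t * (ddt I (K 2) t + 3 * tors 2 t * tors 3 t) = 0"
      using p3[OF that] k1 by (simp add: b_def m_def algebra_simps)
    then show ?thesis using k by simp
  qed
  show "K 2 t * K 3 t = - 3 * tors 2 t * tors 4 t" if "4 \<le> d"
  proof -
    have "K 1 t * (K 2 t * K 3 t + 3 * tors 2 t * tors 4 t) = 0"
      using p4[OF that] by (simp add: c_def m_def algebra_simps)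
    then show ?thesis using k by simp
  qed
  \<comment> \<open>Beyond the osculating order there is no scalar equation, but there the frame vector is \<open>0\<close>.\<close>
  have "a *\<^sub>R F 2 t = - (m * tors 2 t) *\<^sub>R F 2 t" using p2 by (simp add: add_eq_0_iff)
  moreover have "b *\<^sub>R F 3 t = - (m * tors 3 t) *\<^sub>R F 3 t"
    using p3 by (cases "3 \<le> d") (simp_all add: F_def add_eq_0_iff2)
  moreover have "c *\<^sub>R F 4 t = - (m * tors 4 t) *\<^sub>R F 4 t"
    using p4 by (cases "4 \<le> d") (simp_all add: F_def add_eq_0_iff2)
  ultimately have "m *\<^sub>R (?J - (tors 2 t *\<^sub>R F 2 t + tors 3 t *\<^sub>R F 3 t + tors 4 t *\<^sub>R F 4 t)) = 0"
    using bit k1 by (simp add: algebra_simps)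
  then show "?J = tors 2 t *\<^sub>R F 2 t + tors 3 t *\<^sub>R F 3 t + tors 4 t *\<^sub>R F 4 t"
    using k assms(4) by (simp add: m_def)
qed

lemma ddt_constant: "t \<in> I \<Longrightarrow> (\<And>s. s \<in> I \<Longrightarrow> f s = c) \<Longrightarrow> ddt I f t = 0"
  using ddt_cong[of t I f "\<lambda>s. c"] ddt_eqI[of "\<lambda>s. c" 0 t] by simp

lemma ddt_tors_2: "t \<in> I \<Longrightarrow> ddt I (tors 2) t = K 2 t * tors 3 t"
  using ddt_tors[of t 2] skew[of t 2] tors_1[of t] by (simp add: numeral_3_eq_3)

text \<open>
  The crux is that \<open>tors 3\<close> vanishes.  Differentiating \<open>(K 1)\<^sup>2 + (K 2)\<^sup>2 = 1 + 3 (tors 2)\<^sup>2\<close>, where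
  \<open>K 1\<close> is constant, gives \<open>2 K 2 K 2' = 6 tors 2 tors 2'\<close>.  The \<open>F 3\<close>-component of the
  bitension says \<open>K 2' = - 3 tors 2 tors 3\<close>, while \<open>tors 2' = K 2 tors 3\<close>.  The two sides
  therefore have opposite signs, and \<open>K 2 tors 2 tors 3 = 0\<close>.
  The osculating order is at least \<open>4\<close>, since otherwise \<open>J (F 1)\<close> would be a multiple of \<open>F 2\<close>,
  hence \<open>tors 2\<close> would be \<open>1\<close> or \<open>-1\<close>.
\<close>

lemma biharmonic_rigidity:
  assumes d: "2 \<le> d" and bi: "biharmonic I \<gamma>" and tor: "\<And>t. t \<in> I \<Longrightarrow> tors 2 t \<notin> {0, 1, - 1}"
  shows "4 \<le> d"
    and "\<And>t. t \<in> I \<Longrightarrow> tors 3 t = 0"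
    and "\<And>t. t \<in> I \<Longrightarrow> (tors 2 t)\<^sup>2 + (tors 4 t)\<^sup>2 = 1"
    and "\<And>t. t \<in> I \<Longrightarrow> (K 1 t)\<^sup>2 + (K 2 t)\<^sup>2 = 1 + 3 * (tors 2 t)\<^sup>2"
    and "\<And>t. t \<in> I \<Longrightarrow> ddt I (K 1) t = 0 \<and> ddt I (K 2) t = 0 \<and> ddt I (tors 2) t = 0
      \<and> ddt I (tors 4) t = 0"
proof -
  have bit: "bitension I \<gamma> t = 0" if "t \<in> I" for t using bi that by (simp add: biharmonic_def)
  have nz: "tors 2 t \<noteq> 0" if "t \<in> I" for t using tor[OF that] by simp
  note comp = biharmonic_components[OF _ bit d nz]
  obtain t\<^sub>0 where t0: "t\<^sub>0 \<in> I" using interior_nonempty interior_subset by blast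
  have unit: "(tors 2 t)\<^sup>2 + (tors 3 t)\<^sup>2 + (tors 4 t)\<^sup>2 = 1" if t: "t \<in> I" for t
  proof -
    let ?J = "cstruct (\<gamma> t) (F 1 t)"
    have "1 = fs_metric ?J ?J"
      using t d_pos by (simp add: cstruct_isometry(1) curve F_tangent F_metric)
    also have "\<dots> = fs_metric ?J (tors 2 t *\<^sub>R F 2 t + tors 3 t *\<^sub>R F 3 t + tors 4 t *\<^sub>R F 4 t)"
      using comp(5)[OF t t t] by simp
    also have "\<dots> = (tors 2 t)\<^sup>2 + (tors 3 t)\<^sup>2 + (tors 4 t)\<^sup>2"
      by (simp add: fs.add_right fs.scaleR_right power2_eq_square tors_def)
    finally show ?thesis by simp
  qed
  have tors2: "(tors 2 t)\<^sup>2 \<noteq> 1" if "t \<in> I" for t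
    using tor[OF that] by (simp add: power2_eq_1_iff)
  have d3: "3 \<le> d"
  proof (rule ccontr)
    assume "\<not> 3 \<le> d"
    then show False using unit[OF t0] tors2[OF t0] by (simp add: tors_zero)
  qed
  have K1': "ddt I (K 1) t = 0" if "t \<in> I" for t using comp(1)[OF that that that] .
  show pyth: "(K 1 t)\<^sup>2 + (K 2 t)\<^sup>2 = 1 + 3 * (tors 2 t)\<^sup>2" if t: "t \<in> I" for t
  proof -
    have "ddt I (ddt I (K 1)) t = 0" using t K1' by (rule ddt_constant)
    then have "K 1 t * ((K 1 t)\<^sup>2 + (K 2 t)\<^sup>2 - (1 + 3 * (tors 2 t)\<^sup>2)) = 0"
      using comp(2)[OF t t t] by (simp add: power2_eq_square power3_eq_cube algebra_simps)
    then show ?thesis using K_pos[of 1, OF _ t] d by simp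
  qed
  show tors3: "tors 3 t = 0" if t: "t \<in> I" for t
  proof -
    have "ddt I (\<lambda>s. (K 1 s)\<^sup>2 + (K 2 s)\<^sup>2) t = ddt I (\<lambda>s. 1 + 3 * (tors 2 s)\<^sup>2) t"
      using t pyth by (intro ddt_cong) simp_all
    moreover have "ddt I (\<lambda>s. (K 1 s)\<^sup>2 + (K 2 s)\<^sup>2) t
        = 2 * K 1 t * ddt I (K 1) t + 2 * K 2 t * ddt I (K 2) t"
      by (intro ddt_eqI[OF _ t] has_vector_derivative_add has_ddt_square K_smooth t)
    moreover have "ddt I (\<lambda>s. 1 + 3 * (tors 2 s)\<^sup>2) t = 0 + 3 * (2 * tors 2 t * ddt I (tors 2) t)"
      by (intro ddt_eqI[OF _ t] has_vector_derivative_add has_vector_derivative_const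
          has_vector_derivative_mult_right has_ddt_square tors_smooth t)
    ultimately have "K 2 t * tors 2 t * tors 3 t = 0"
      using comp(3)[OF t t t d3] ddt_tors_2[OF t] K1'[OF t] by simp
    then show ?thesis using K_pos[of 2, OF _ t] d3 nz[OF t] by simp
  qed
  show d4: "4 \<le> d"
  proof (rule ccontr)
    assume "\<not> 4 \<le> d"
    then show False using unit[OF t0] tors2[OF t0] tors3[OF t0] by (simp add: tors_zero)
  qed
  show unit': "(tors 2 t)\<^sup>2 + (tors 4 t)\<^sup>2 = 1" if t: "t \<in> I" for t
    using unit[OF t] tors3[OF t] by simp
  show "ddt I (K 1) t = 0 \<and> ddt I (K 2) t = 0 \<and> ddt I (tors 2) t = 0 \<and> ddt I (tors 4) t = 0"
    if t: "t \<in> I" for t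
  proof -
    have 2: "ddt I (tors 2) t = 0" using ddt_tors_2[OF t] tors3[OF t] by simp
    \<comment> \<open>The square of \<open>tors 4\<close> is constant and \<open>tors 4\<close> has no zeros.\<close>
    have "ddt I (\<lambda>s. (tors 2 s)\<^sup>2 + (tors 4 s)\<^sup>2) t = 0"
      using t unit' by (rule ddt_constant)
    moreover have "ddt I (\<lambda>s. (tors 2 s)\<^sup>2 + (tors 4 s)\<^sup>2) t
        = 2 * tors 2 t * ddt I (tors 2) t + 2 * tors 4 t * ddt I (tors 4) t"
      by (intro ddt_eqI[OF _ t] has_vector_derivative_add has_ddt_square tors_smooth t)
    moreover have "tors 4 t \<noteq> 0" using unit'[OF t] tors2[OF t] by auto
    ultimately show ?thesis using 2 K1'[OF t] comp(3)[OF t t t d3] tors3[OF t] by simp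
  qed
qed

lemma complex_torsion_tors:
  assumes "t \<in> I" "2 \<le> d"
  shows "complex_torsion \<gamma> E 1 2 t = - tors 2 t"
  using fs_F_cstruct[OF assms(1), of 2] F_eq[of 1] F_eq[of 2] assms by (simp add: complex_torsion_def)

lemma not_harmonic:
  assumes "2 \<le> d"
  shows "\<not> harmonic I \<gamma>"
proof
  assume h: "harmonic I \<gamma>"
  obtain t where t: "t \<in> I" using interior_nonempty interior_subset by blast
  have "K 1 t *\<^sub>R F 2 t = 0" using h t tension_F[OF t] by (simp add: harmonic_def)
  then have "fs_metric (K 1 t *\<^sub>R F 2 t) (F 2 t) = 0" by (simp only: fs.zero_left)
  then show False using K_pos[of 1, OF _ t] assms t by (simp add: fs.scaleR_left F_metric)
qed

text \<open>
  For constant curvatures only the \<open>F 2\<close>- and \<open>F 4\<close>-components of the bitension remain, and the two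
  relations between \<open>x\<close>, \<open>y\<close> and the curvatures are exactly their vanishing.
\<close>

lemma bitension_zero_of_helix:
  assumes t: "t \<in> I"
    and const: "\<And>s. s \<in> I \<Longrightarrow> K 1 s = c\<^sub>1" "\<And>s. s \<in> I \<Longrightarrow> K 2 s = c\<^sub>2"
    and J: "cstruct (\<gamma> t) (F 1 t) = x *\<^sub>R F 2 t + y *\<^sub>R F 4 t" and x: "tors 2 t = x"
    and pyth: "(K 1 t)\<^sup>2 + (K 2 t)\<^sup>2 = 1 + 3 * x\<^sup>2" and prod: "K 2 t * K 3 t = - 3 * x * y"
  shows "bitension I \<gamma> t = 0"
proof -
  have D: "ddt I (K 1) s = 0" "ddt I (K 2) s = 0" if "s \<in> I" for s
    using that const by (auto intro: ddt_constant)
  then have "ddt I (ddt I (K 1)) t = 0" using t by (intro ddt_constant)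
  then have "bitension I \<gamma> t = (- K 1 t * ((K 1 t)\<^sup>2 + (K 2 t)\<^sup>2) + K 1 t + 3 * K 1 t * x * x) *\<^sub>R F 2 t
      + (K 1 t * (K 2 t * K 3 t) + 3 * K 1 t * x * y) *\<^sub>R F 4 t"
    using bitension_F[OF t] D[OF t] fs_F_cstruct[OF t, of 2] x unfolding J
    by (simp add: algebra_simps power2_eq_square power3_eq_cube)
  also have "\<dots> = 0" unfolding pyth prod by (simp add: algebra_simps power2_eq_square)
  finally show ?thesis .
qed

end

theorem proposition5p9:
  fixes n d :: nat
    and I :: "real set"
    and \<gamma> :: "real \<Rightarrow> complex ^ 'm ^ 'm"
    and E :: "nat \<Rightarrow> real \<Rightarrow> complex ^ 'm ^ 'm"
    and k :: "nat \<Rightarrow> real \<Rightarrow> real"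
  assumes "n \<ge> 2" and "CARD('m) = n + 1"
    and "frenet_curve I \<gamma> d E k"
    and "2 \<le> d"
    and "\<forall>t\<in>I. complex_torsion \<gamma> E 1 2 t \<notin> {0, 1, -1}"
  shows "proper_biharmonic I \<gamma> \<longleftrightarrow>
    (\<exists>\<alpha>\<^sub>0 :: real. \<alpha>\<^sub>0 \<in> {pi / 2 <..< pi} \<union> {3 * pi / 2 <..< 2 * pi} \<and>
       4 \<le> d \<and>
       (\<forall>t\<in>I. cstruct (\<gamma> t) (E 1 t) = cos \<alpha>\<^sub>0 *\<^sub>R E 2 t + sin \<alpha>\<^sub>0 *\<^sub>R E 4 t) \<and>
       (\<forall>i\<in>{1, 2, 3}. \<exists>c > 0. \<forall>t\<in>I. k i t = c) \<and>
       (\<forall>t\<in>I. (k 1 t)\<^sup>2 + (k 2 t)\<^sup>2 = 1 + 3 * (cos \<alpha>\<^sub>0)\<^sup>2) \<and>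
       (\<forall>t\<in>I. k 2 t * k 3 t = - (3 / 2) * sin (2 * \<alpha>\<^sub>0)) \<and>
       (\<forall>t\<in>I. complex_torsion \<gamma> E 1 2 t = - cos \<alpha>\<^sub>0))" (is "_ \<longleftrightarrow> (\<exists>\<alpha>. ?R \<alpha>)")
proof -
  interpret frenet I \<gamma> d E k by unfold_locales (rule assms(3))
  have tor: "tors 2 t \<notin> {0, 1, - 1}" if "t \<in> I" for t
    using assms(5) that complex_torsion_tors[OF that assms(4)] by force
  obtain t\<^sub>0 where t0: "t\<^sub>0 \<in> I" using interior_nonempty interior_subset by blast
  show ?thesis
  proof
    assume "proper_biharmonic I \<gamma>"
    then have bi: "biharmonic I \<gamma>" by (simp add: proper_biharmonic_def)
    note rigid = biharmonic_rigidity[OF assms(4) bi tor]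
    note comp = biharmonic_components[OF _ _ assms(4)]
    have d: "4 \<le> d" by (rule rigid(1))
    have F: "F 1 = E 1" "F 2 = E 2" "F 4 = E 4" using d by (auto simp: F_def)
    have K: "K 1 = k 1" "K 2 = k 2" "K 3 = k 3" using d by (auto simp: K_def)
    have pos: "k 1 t > 0" "k 2 t > 0" "k 3 t > 0" if "t \<in> I" for t
      using K_pos[of 1 t] K_pos[of 2 t] K_pos[of 3 t] K d that by auto
    obtain c\<^sub>1 where c1: "\<And>t. t \<in> I \<Longrightarrow> k 1 t = c\<^sub>1"
      using constant_of_ddt_0[OF K_smooth[of 1]] rigid(5) K by metis
    obtain c\<^sub>2 where c2: "\<And>t. t \<in> I \<Longrightarrow> k 2 t = c\<^sub>2"
      using constant_of_ddt_0[OF K_smooth[of 2]] rigid(5) K by metis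
    obtain x where x: "\<And>t. t \<in> I \<Longrightarrow> tors 2 t = x"
      using constant_of_ddt_0[OF tors_smooth[of 2]] rigid(5) by metis
    obtain y where y: "\<And>t. t \<in> I \<Longrightarrow> tors 4 t = y"
      using constant_of_ddt_0[OF tors_smooth[of 4]] rigid(5) by metis
    have prod: "k 2 t * k 3 t = - 3 * x * y" if "t \<in> I" for t
      using comp(4)[OF that] bi tor[OF that] that d K x y by (simp add: biharmonic_def)
    have "x * y < 0" using prod[OF t0] mult_pos_pos[OF pos(2,3)[OF t0]] by simp
    moreover have "x\<^sup>2 + y\<^sup>2 = 1" using rigid(3)[OF _ t0] t0 x y by simp
    ultimately obtain \<alpha> where \<alpha>: "\<alpha> \<in> {pi / 2 <..< pi} \<union> {3 * pi / 2 <..< 2 * pi}"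
      "x = cos \<alpha>" "y = sin \<alpha>"
      using second_or_fourth_quadrant by metis
    have "k 3 t = k 3 t\<^sub>0" if "t \<in> I" for t
    proof -
      have "k 2 t\<^sub>0 * k 3 t = k 2 t\<^sub>0 * k 3 t\<^sub>0"
        using prod[OF that] prod[OF t0] c2[OF that] c2[OF t0] by simp
      then show ?thesis using pos(2)[OF t0] by simp
    qed
    then have "\<exists>c > 0. \<forall>t\<in>I. k 3 t = c" using pos(3)[OF t0] by blast
    moreover have "\<exists>c > 0. \<forall>t\<in>I. k 1 t = c" "\<exists>c > 0. \<forall>t\<in>I. k 2 t = c"
      using c1 c2 pos(1,2)[OF t0] t0 by metis+
    ultimately have "\<forall>i\<in>{1, 2, 3}. \<exists>c > 0. \<forall>t\<in>I. k i t = c"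
      by simp
    moreover have "cstruct (\<gamma> t) (E 1 t) = cos \<alpha> *\<^sub>R E 2 t + sin \<alpha> *\<^sub>R E 4 t" if "t \<in> I" for t
      using comp(5)[OF that] bi tor[OF that] that rigid(2)[OF _ that] x y \<alpha> F by (simp add: biharmonic_def)
    moreover have "(k 1 t)\<^sup>2 + (k 2 t)\<^sup>2 = 1 + 3 * (cos \<alpha>)\<^sup>2" if "t \<in> I" for t
      using rigid(4)[OF _ that] that x \<alpha> K by simp
    moreover have "k 2 t * k 3 t = - (3 / 2) * sin (2 * \<alpha>)" if "t \<in> I" for t
      using prod[OF that] \<alpha> by (simp add: sin_double)
    moreover have "complex_torsion \<gamma> E 1 2 t = - cos \<alpha>" if "t \<in> I" for t
      using complex_torsion_tors[OF that assms(4)] x[OF that] \<alpha> by simp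
    ultimately show "\<exists>\<alpha>. ?R \<alpha>" using \<alpha>(1) d by blast
  next
    assume "\<exists>\<alpha>. ?R \<alpha>"
    then obtain \<alpha> where d: "4 \<le> d"
      and J: "\<forall>t\<in>I. cstruct (\<gamma> t) (E 1 t) = cos \<alpha> *\<^sub>R E 2 t + sin \<alpha> *\<^sub>R E 4 t"
      and const: "\<forall>i\<in>{1, 2, 3}. \<exists>c > 0. \<forall>t\<in>I. k i t = c"
      and pyth: "\<forall>t\<in>I. (k 1 t)\<^sup>2 + (k 2 t)\<^sup>2 = 1 + 3 * (cos \<alpha>)\<^sup>2"
      and prod: "\<forall>t\<in>I. k 2 t * k 3 t = - (3 / 2) * sin (2 * \<alpha>)"
      and \<tau>: "\<forall>t\<in>I. complex_torsion \<gamma> E 1 2 t = - cos \<alpha>"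
      by (elim exE conjE)
    have F: "F 1 = E 1" "F 2 = E 2" "F 4 = E 4" using d by (auto simp: F_def)
    have K: "K 1 = k 1" "K 2 = k 2" "K 3 = k 3" using d by (auto simp: K_def)
    obtain c\<^sub>1 c\<^sub>2 where c: "\<And>t. t \<in> I \<Longrightarrow> K 1 t = c\<^sub>1" "\<And>t. t \<in> I \<Longrightarrow> K 2 t = c\<^sub>2"
      using bspec[OF const, of 1] bspec[OF const, of 2] unfolding K by auto
    have "bitension I \<gamma> t = 0" if t: "t \<in> I" for t
    proof (rule bitension_zero_of_helix[OF t c])
      show "cstruct (\<gamma> t) (F 1 t) = cos \<alpha> *\<^sub>R F 2 t + sin \<alpha> *\<^sub>R F 4 t"
        "(K 1 t)\<^sup>2 + (K 2 t)\<^sup>2 = 1 + 3 * (cos \<alpha>)\<^sup>2"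
        using bspec[OF J t] bspec[OF pyth t] unfolding F K .
      show "tors 2 t = cos \<alpha>"
        using bspec[OF \<tau> t] complex_torsion_tors[OF t assms(4)] by simp
      show "K 2 t * K 3 t = - 3 * cos \<alpha> * sin \<alpha>"
        using bspec[OF prod t] unfolding K by (simp add: sin_double)
    qed
    then show "proper_biharmonic I \<gamma>"
      using not_harmonic[OF assms(4)] by (simp add: proper_biharmonic_def biharmonic_def)
  qed
qed

end
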